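(* Fix $K,M>1$, $\delta\in(0,1)$ and an instance $\boldsymbol\mu\in\mathbb{R}^{K\times M}$ with unique local best arms and unique global best arm. For any $\delta$-PAC algorithm $\pi$, let $T^\pi_\delta$ be the total number of arm pulls (over all clients) made by $\pi$ until termination. Then $$\inf_{\pi\ \delta\text{-PAC}}\mathbb{E}^\pi_{\boldsymbol\mu}[T^\pi_\delta]\ \ge\ \sum_{k=1}^K\sum_{m=1}^M\max\Big\{\frac{\ln\frac{1}{2.4\delta}}{\Delta_{k,m}^2},\ \frac{\ln\frac{1}{2.4\delta}}{M^2\Delta_k^2}\Big\}.$$
   Context: Setting: $M$ clients, each with arms $[K]$; at each pull of arm $k$ of client $m$ an independent $\mathcal N(\mu_{k,m},1)$ reward is observed; the instance $\boldsymbol\mu=[\mu_{k,m}]$ is unknown. $k_m^*=\arg\max_k\mu_{k,m}$, $\mu_k=\frac1M\sum_m\mu_{k,m}$, $k^*=\arg\max_k\mu_k$. Gaps: $\Delta_{k,m}=\mu_{k_m^*,m}-\mu_{k,m}$ ($k\ne k_m^*$), $\Delta_{k_m^*,m}=\min_{k\ne k_m^*}\Delta_{k,m}$; $\Delta_k=\mu_{k^*}-\mu_k$ ($k\ne k^*$), $\Delta_{k^*}=\min_{k\ne k^*}\Delta_k$. An algorithm sequentially chooses arms to pull (based on past observations, with clients and server able to share all information at every step), stops at a (random) time, and outputs $(\hat k_1^*,\dots,\hat k_M^*,\hat k^* )$; it is $\delta$-PAC if for every instance with unique local and global best arms it outputs $(k_1^*,\dots,k_M^*,k^* )$ with probability at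 least $1-\delta$. $\mathbb E^\pi_{\boldsymbol\mu}$ is expectation under $\pi$ and instance $\boldsymbol\mu$. *)

theory Defs
  imports "HOL-Probability.Probability"
begin

text \<open>Arms are indexed by k < K, clients by m < M. An instance is mu :: nat => nat => real,
  with mu k m the mean of arm k of client m.\<close>

definition is_local_best :: "(nat \<Rightarrow> nat \<Rightarrow> real) \<Rightarrow> nat \<Rightarrow> nat \<Rightarrow> nat \<Rightarrow> bool" where
  "is_local_best mu K m k \<longleftrightarrow> k < K \<and> (\<forall>j<K. j \<noteq> k \<longrightarrow> mu j m < mu k m)"

definition local_best :: "(nat \<Rightarrow> nat \<Rightarrow> real) \<Rightarrow> nat \<Rightarrow> nat \<Rightarrow> nat" where
  "local_best mu K m = (THE k. is_local_best mu K m k)"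

definition global_mean :: "(nat \<Rightarrow> nat \<Rightarrow> real) \<Rightarrow> nat \<Rightarrow> nat \<Rightarrow> real" where
  "global_mean mu M k = (\<Sum>m<M. mu k m) / real M"

definition is_global_best :: "(nat \<Rightarrow> nat \<Rightarrow> real) \<Rightarrow> nat \<Rightarrow> nat \<Rightarrow> nat \<Rightarrow> bool" where
  "is_global_best mu K M k \<longleftrightarrow> k < K \<and> (\<forall>j<K. j \<noteq> k \<longrightarrow> global_mean mu M j < global_mean mu M k)"

definition global_best :: "(nat \<Rightarrow> nat \<Rightarrow> real) \<Rightarrow> nat \<Rightarrow> nat \<Rightarrow> nat" where
  "global_best mu K M = (THE k. is_global_best mu K M k)"

definition unique_bests :: "(nat \<Rightarrow> nat \<Rightarrow> real) \<Rightarrow> nat \<Rightarrow> nat \<Rightarrow> bool" where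
  "unique_bests mu K M \<longleftrightarrow> (\<forall>m<M. \<exists>k. is_local_best mu K m k) \<and> (\<exists>k. is_global_best mu K M k)"

definition gap_loc :: "(nat \<Rightarrow> nat \<Rightarrow> real) \<Rightarrow> nat \<Rightarrow> nat \<Rightarrow> nat \<Rightarrow> real" where
  "gap_loc mu K k m =
     (let b = local_best mu K m in
      if k = b then Min {mu b m - mu j m | j. j < K \<and> j \<noteq> b} else mu b m - mu k m)"

definition gap_glob :: "(nat \<Rightarrow> nat \<Rightarrow> real) \<Rightarrow> nat \<Rightarrow> nat \<Rightarrow> nat \<Rightarrow> real" where
  "gap_glob mu K M k =
     (let b = global_best mu K M in
      if k = b then Min {global_mean mu M b - global_mean mu M j | j. j < K \<and> j \<noteq> b}
      else global_mean mu M b - global_mean mu M k)"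

text \<open>Algorithms. At each step the algorithm, given its internal randomness u and the history
  of (arm, client, reward) observations, either pulls arm k of client m, or stops and outputs
  (local best arm estimates as a function of the client, global best arm estimate).\<close>
datatype action = Pull nat nat | Stop "nat \<Rightarrow> nat" nat

type_synonym history = "(nat \<times> nat \<times> real) list"
type_synonym 'r policy = "'r \<Rightarrow> history \<Rightarrow> action"

text \<open>Reward-table model: omega (k, m, n) is the reward obtained at the n-th pull (counting from 0)
  of arm k of client m; these are independent N(mu k m, 1).\<close>
type_synonym table = "nat \<times> nat \<times> nat \<Rightarrow> real"

fun run_hist :: "'r policy \<Rightarrow> 'r \<Rightarrow> table \<Rightarrow> nat \<Rightarrow> history" where
  "run_hist alg u w 0 = []"
| "run_hist alg u w (Suc t) =
     (let h = run_hist alg u w t in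
      case alg u h of
        Pull k m \<Rightarrow> h @ [(k, m, w (k, m, length (filter (\<lambda>(k', m', _). k' = k \<and> m' = m) h)))]
      | Stop _ _ \<Rightarrow> h)"

definition is_stop :: "action \<Rightarrow> bool" where
  "is_stop a \<longleftrightarrow> (case a of Stop _ _ \<Rightarrow> True | Pull _ _ \<Rightarrow> False)"

definition stopped :: "'r policy \<Rightarrow> 'r \<Rightarrow> table \<Rightarrow> bool" where
  "stopped alg u w \<longleftrightarrow> (\<exists>t. is_stop (alg u (run_hist alg u w t)))"

definition first_stop :: "'r policy \<Rightarrow> 'r \<Rightarrow> table \<Rightarrow> nat" where
  "first_stop alg u w = (LEAST t. is_stop (alg u (run_hist alg u w t)))"

definition stop_time :: "'r policy \<Rightarrow> 'r \<Rightarrow> table \<Rightarrow> ennreal" where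
  "stop_time alg u w = (if stopped alg u w then of_nat (first_stop alg u w) else \<infinity>)"

definition alg_output :: "'r policy \<Rightarrow> 'r \<Rightarrow> table \<Rightarrow> action" where
  "alg_output alg u w = alg u (run_hist alg u w (first_stop alg u w))"

definition correct_output :: "(nat \<Rightarrow> nat \<Rightarrow> real) \<Rightarrow> nat \<Rightarrow> nat \<Rightarrow> 'r policy \<Rightarrow> 'r \<Rightarrow> table \<Rightarrow> bool" where
  "correct_output mu K M alg u w \<longleftrightarrow> stopped alg u w \<and>
     (case alg_output alg u w of
        Stop loc g \<Rightarrow> (\<forall>m<M. loc m = local_best mu K m) \<and> g = global_best mu K M
      | Pull _ _ \<Rightarrow> False)"

definition model :: "'r measure \<Rightarrow> (nat \<Rightarrow> nat \<Rightarrow> real) \<Rightarrow> ('r \<times> table) measure" where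
  "model R mu = R \<Otimes>\<^sub>M (PiM UNIV (\<lambda>(k, m, n). density lborel (normal_density (mu k m) 1)))"

definition valid_policy :: "nat \<Rightarrow> nat \<Rightarrow> 'r policy \<Rightarrow> bool" where
  "valid_policy K M alg \<longleftrightarrow> (\<forall>u h k m. alg u h = Pull k m \<longrightarrow> k < K \<and> m < M)"

definition delta_PAC :: "'r measure \<Rightarrow> nat \<Rightarrow> nat \<Rightarrow> real \<Rightarrow> 'r policy \<Rightarrow> bool" where
  "delta_PAC R K M \<delta> alg \<longleftrightarrow>
     (\<forall>mu. unique_bests mu K M \<longrightarrow>
        measure (model R mu) {x \<in> space (model R mu). correct_output mu K M alg (fst x) (snd x)} \<ge> 1 - \<delta>)"

end

theory Submission
  imports Defs
begin

text \<open>Moving the single mean \<open>\<mu>\<^sub>k\<^sub>m\<close> by \<open>\<Delta>\<^sub>k\<^sub>m\<close> (or by \<open>M \<Delta>\<^sub>k\<close>) creates a tie between the local (or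
  global) best arm and another arm, so arbitrarily close to the moved instance there is an
  instance with unique best arms and a different correct answer. Transporting the event of a
  correct answer by the Donsker--Varadhan inequality bounds the expected number of pulls of arm
  \<open>k\<close> of client \<open>m\<close> from below by \<open>2 kl(1 - \<delta>, \<delta>)\<close> divided by the squared displacement, and
  \<open>2 kl(1 - \<delta>, \<delta>) \<ge> ln (1 / (2.4 \<delta>))\<close>. Summing over \<open>k\<close> and \<open>m\<close> gives the bound.

  The decisions of the policy are not assumed to be measurable; only the stopping time is, and
  the events of a correct answer are as a consequence of the PAC property. Therefore expected
  pull counts are defined as iterated lower integrals along the history. Superadditivity of the
  lower integral is all that the summation needs, and each step of the change of measure
  integrates only conditional expectations of measurable functions of the reward table.\<close>

subsection \<open>Lower integrals\<close>

text \<open>For arbitrary \<open>f\<close> the integral is the supremum of the integrals of the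
  simple functions below \<open>f\<close>. Countably many of them already approach that supremum,
  and their pointwise supremum is a measurable minorant with the same integral.\<close>

lemma nn_integral_measurable_minorant:
  obtains g where "g \<in> borel_measurable M" "\<And>x. g x \<le> f x" "(\<integral>\<^sup>+x. g x \<partial>M) = (\<integral>\<^sup>+x. f x \<partial>M)"
proof -
  let ?A = "{g. simple_function M g \<and> g \<le> f}"
  have "(\<lambda>_. 0) \<in> ?A" by (auto simp: le_fun_def)
  then have "?A \<noteq> {}" by blast
  from ennreal_SUP_countable_SUP[OF this, of "integral\<^sup>S M"]
  obtain s :: "nat \<Rightarrow> ennreal"
    where s: "range s \<subseteq> integral\<^sup>S M ` ?A" "Sup (integral\<^sup>S M ` ?A) = Sup (range s)"
    by (elim exE conjE)
  have "\<exists>g. g \<in> ?A \<and> s i = integral\<^sup>S M g" for i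
    using subsetD[OF s(1) rangeI[of s i]] by (auto simp: image_iff)
  then obtain G where G: "\<And>i::nat. G i \<in> ?A" "\<And>i. s i = integral\<^sup>S M (G i)" by metis
  have [measurable]: "G i \<in> borel_measurable M" for i
    using G(1)[of i] by (auto intro: borel_measurable_simple_function)
  define g where "g = (\<lambda>x. SUP i. G i x)"
  have gm: "g \<in> borel_measurable M" unfolding g_def by measurable
  have gf: "g x \<le> f x" for x
    unfolding g_def using G(1) by (auto intro!: SUP_least simp: le_fun_def)
  have "s i \<le> integral\<^sup>N M g" for i
  proof -
    have "simple_function M (G i)" using G(1)[of i] by blast
    then have "s i = integral\<^sup>N M (G i)"
      unfolding G(2) by (rule nn_integral_eq_simple_integral[symmetric])
    also have "\<dots> \<le> integral\<^sup>N M g"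
      unfolding g_def by (rule nn_integral_mono) (rule SUP_upper, simp)
    finally show ?thesis .
  qed
  then have "Sup (range s) \<le> integral\<^sup>N M g" by (rule SUP_least)
  moreover have "integral\<^sup>N M f = Sup (range s)"
    unfolding nn_integral_def[of M f] by (rule s(2))
  moreover have "integral\<^sup>N M g \<le> integral\<^sup>N M f"
    by (rule nn_integral_mono) (rule gf)
  ultimately have "integral\<^sup>N M g = integral\<^sup>N M f" by (intro antisym) simp_all
  with gm gf show ?thesis by (rule that)
qed

text \<open>Both functions are replaced by measurable minorants with the same integrals, for which
  the integral is additive.\<close>

lemma nn_integral_superadditive:
  "(\<integral>\<^sup>+x. f x \<partial>M) + (\<integral>\<^sup>+x. g x \<partial>M) \<le> (\<integral>\<^sup>+x. f x + g x \<partial>M)"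
proof -
  obtain f' where f': "f' \<in> borel_measurable M" "\<And>x. f' x \<le> f x" "(\<integral>\<^sup>+x. f' x \<partial>M) = (\<integral>\<^sup>+x. f x \<partial>M)"
    using nn_integral_measurable_minorant[of M f] by metis
  obtain g' where g': "g' \<in> borel_measurable M" "\<And>x. g' x \<le> g x" "(\<integral>\<^sup>+x. g' x \<partial>M) = (\<integral>\<^sup>+x. g x \<partial>M)"
    using nn_integral_measurable_minorant[of M g] by metis
  have "(\<integral>\<^sup>+x. f x \<partial>M) + (\<integral>\<^sup>+x. g x \<partial>M) = (\<integral>\<^sup>+x. f' x + g' x \<partial>M)"
    using f' g' by (simp add: nn_integral_add)
  also have "\<dots> \<le> (\<integral>\<^sup>+x. f x + g x \<partial>M)"
    using f'(2) g'(2) by (intro nn_integral_mono add_mono)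
  finally show ?thesis .
qed

lemma nn_integral_sum_superadditive:
  "(\<Sum>i\<in>I. \<integral>\<^sup>+x. f i x \<partial>M) \<le> (\<integral>\<^sup>+x. (\<Sum>i\<in>I. f i x) \<partial>M)"
proof (induction I rule: infinite_finite_induct)
  case (insert i I)
  then have "(\<Sum>i\<in>insert i I. \<integral>\<^sup>+x. f i x \<partial>M)
      \<le> (\<integral>\<^sup>+x. f i x \<partial>M) + (\<integral>\<^sup>+x. (\<Sum>i\<in>I. f i x) \<partial>M)"
    by (auto intro: add_left_mono)
  also have "\<dots> \<le> (\<integral>\<^sup>+x. (\<Sum>i\<in>insert i I. f i x) \<partial>M)"
    using insert nn_integral_superadditive by simp
  finally show ?case .
qed auto

text \<open>\<open>ennreal\<close> truncates at 0, so the right side integrates the positive part of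
  \<open>f\<close>.\<close>

lemma ennreal_integral_le_nn_integral:
  fixes f :: "'a \<Rightarrow> real"
  assumes "integrable M f"
  shows "ennreal (\<integral>x. f x \<partial>M) \<le> (\<integral>\<^sup>+x. ennreal (f x) \<partial>M)"
proof -
  have "ennreal (\<integral>x. f x \<partial>M) \<le> ennreal (\<integral>x. max 0 (f x) \<partial>M)"
    using assms by (intro ennreal_leI integral_mono) auto
  also have "\<dots> = (\<integral>\<^sup>+x. ennreal (max 0 (f x)) \<partial>M)"
    using assms by (intro nn_integral_eq_integral[symmetric]) auto
  also have "\<dots> = (\<integral>\<^sup>+x. ennreal (f x) \<partial>M)"
    by (intro nn_integral_cong) (auto simp: max_def ennreal_neg)
  finally show ?thesis .
qed

section \<open>Jensen's inequality and the relative entropy of Gaussians\<close>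

lemma (in prob_space) integral_le_ln_integral_exp:
  fixes f :: "'a \<Rightarrow> real"
  assumes "integrable M f" "integrable M (\<lambda>x. exp (f x))"
  shows "(\<integral>x. f x \<partial>M) \<le> ln (\<integral>x. exp (f x) \<partial>M)"
proof -
  have "exp (expectation f) \<le> expectation (\<lambda>x. exp (f x))"
    using assms exp_convex by (intro jensens_inequality[where q = exp and X = f and I = UNIV]) simp_all
  then show ?thesis
    by (metis exp_gt_zero ln_exp ln_mono less_le_trans)
qed

abbreviation gauss :: "real \<Rightarrow> real measure" where
  "gauss m \<equiv> density lborel (normal_density m 1)"

lemma prob_space_gauss: "prob_space (gauss m)"
  by (rule prob_space_normal_density) simp

text \<open>Donsker--Varadhan for two Gaussians: \<open>(b - a)\<^sup>2 / 2\<close> is the relative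
  entropy of \<open>gauss a\<close> with respect to \<open>gauss b\<close>. Rewriting the right side
  under \<open>gauss a\<close> adds the log-likelihood ratio to the exponent, and Jensen applies to
  the sum.\<close>

lemma gauss_ln_integral_exp:
  assumes g [measurable]: "g \<in> borel_measurable borel" and bd: "\<And>x. \<bar>g x\<bar> \<le> c"
  shows "(\<integral>x. g x \<partial>gauss a) - (b - a)\<^sup>2 / 2 \<le> ln (\<integral>x. exp (g x) \<partial>gauss b)"
proof -
  interpret A: prob_space "gauss a" by (rule prob_space_gauss)
  interpret B: prob_space "gauss b" by (rule prob_space_gauss)
  \<comment> \<open>The log-likelihood ratio of \<open>gauss b\<close> to \<open>gauss a\<close>;
    its mean under \<open>gauss a\<close> is minus the relative entropy.\<close>
  define l where "l = (\<lambda>x. (b - a) * (x - a) - (b - a)\<^sup>2 / 2)"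
  have [measurable]: "l \<in> borel_measurable borel" unfolding l_def by measurable
  have ratio: "normal_density b 1 x = normal_density a 1 x * exp (l x)" for x
  proof -
    have "- (x - b)\<^sup>2 / 2 = - (x - a)\<^sup>2 / 2 + l x"
      by (simp add: l_def power2_eq_square field_simps)
    then show ?thesis
      by (simp add: normal_density_def exp_add[symmetric])
  qed
  have ig: "integrable (gauss a) g"
    using bd by (intro A.integrable_const_bound[where B = c]) auto
  have ix: "integrable (gauss a) (\<lambda>x. x - a)"
    using integrable_normal_moment[of 1 a 1] by (subst integrable_density) auto
  have x0: "(\<integral>x. x - a \<partial>gauss a) = 0"
    using integral_normal_moment_odd[of 1 a 0] by (subst integral_density) auto
  have il: "integrable (gauss a) l"
    unfolding l_def using ix by auto
  have l0: "(\<integral>x. l x \<partial>gauss a) = - (b - a)\<^sup>2 / 2"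
    unfolding l_def using ix x0 A.prob_space by (subst Bochner_Integration.integral_diff) auto
  have ieb: "integrable (gauss b) (\<lambda>x. exp (g x))"
    using bd by (intro B.integrable_const_bound[where B = "exp c"]) (auto simp: abs_le_iff)
  have iea: "integrable (gauss a) (\<lambda>x. exp (g x + l x))"
    using ieb by (simp add: integrable_density ratio exp_add mult_ac)
  have eq: "(\<integral>x. exp (g x) \<partial>gauss b) = (\<integral>x. exp (g x + l x) \<partial>gauss a)"
    by (simp add: integral_density ratio exp_add mult_ac)
  have "(\<integral>x. g x + l x \<partial>gauss a) \<le> ln (\<integral>x. exp (g x + l x) \<partial>gauss a)"
    using ig il iea by (intro A.integral_le_ln_integral_exp) auto
  then show ?thesis using ig il l0 eq by simp
qed

subsection \<open>Reward tables\<close>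

definition table_measure :: "(nat \<Rightarrow> nat \<Rightarrow> real) \<Rightarrow> table measure" where
  "table_measure mu = PiM UNIV (\<lambda>(k, m, n). gauss (mu k m))"

lemma model_eq: "model R mu = R \<Otimes>\<^sub>M table_measure mu"
  by (simp add: model_def table_measure_def)

lemma prob_space_table_measure: "prob_space (table_measure mu)"
  unfolding table_measure_def
  by (rule prob_space_PiM) (auto split: prod.split intro: prob_space_gauss)

lemma space_table_measure [simp]: "space (table_measure mu) = UNIV"
  by (auto simp: table_measure_def space_PiM split: prod.split)

lemma sets_table_measure: "sets (table_measure mu) = sets (PiM UNIV (\<lambda>_. borel))"
  unfolding table_measure_def by (rule sets_PiM_cong) (auto split: prod.split)

lemma measurable_table_measure:
  "measurable (table_measure mu) L = measurable (PiM UNIV (\<lambda>_. borel)) L"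
  by (rule measurable_cong_sets) (auto simp: sets_table_measure)

lemma sets_model: "sets (model R mu) = sets (model R mu')"
  unfolding model_eq by (rule sets_pair_measure_cong) (auto simp: sets_table_measure)

lemma measurable_table_upd [measurable]:
  "(\<lambda>(x, w). w(c := x)) \<in> gauss a \<Otimes>\<^sub>M table_measure mu \<rightarrow>\<^sub>M table_measure mu"
proof -
  have s: "sets (gauss a \<Otimes>\<^sub>M table_measure mu) = sets (borel \<Otimes>\<^sub>M PiM UNIV (\<lambda>_. borel))"
    by (rule sets_pair_measure_cong) (auto simp: sets_table_measure)
  have "(\<lambda>(x, w). w(c := x)) \<in> borel \<Otimes>\<^sub>M PiM UNIV (\<lambda>_. borel) \<rightarrow>\<^sub>M PiM UNIV (\<lambda>_. borel :: real measure)"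
    by (rule measurable_PiM_single') (auto simp: fun_upd_def space_PiM split_beta)
  then show ?thesis
    by (simp add: measurable_cong_sets[OF s sets_table_measure])
qed

lemma measurable_table_upd' [measurable]:
  "(\<lambda>w. w(c := x)) \<in> table_measure mu \<rightarrow>\<^sub>M table_measure mu"
  using measurable_compose[OF measurable_Pair1'[of x "gauss 0" "table_measure mu"] measurable_table_upd]
  by simp

text \<open>Overwriting one coordinate by an independent copy preserves the product law: the library
  fact about inserting an index is applied to an index that is already present.\<close>

lemma distr_table_upd:
  "distr (gauss (mu k m) \<Otimes>\<^sub>M table_measure mu) (table_measure mu) (\<lambda>(x, w). w((k, m, i) := x))
     = table_measure mu"
proof -
  have "distr ((\<lambda>(k, m, n). gauss (mu k m)) (k, m, i) \<Otimes>\<^sub>M PiM UNIV (\<lambda>(k, m, n). gauss (mu k m)))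
      (PiM (insert (k, m, i) UNIV) (\<lambda>(k, m, n). gauss (mu k m))) (\<lambda>(x, w). w((k, m, i) := x))
      = PiM (insert (k, m, i) UNIV) (\<lambda>(k, m, n). gauss (mu k m))"
    by (rule distr_pair_PiM_eq_PiM) (auto split: prod.split intro: prob_space_gauss)
  then show ?thesis by (simp add: table_measure_def)
qed

text \<open>One step of exploration: the reward about to be observed is drawn first, and the rest of
  the table is integrated afterwards.\<close>

lemma nn_integral_table_upd:
  assumes F: "F \<in> borel_measurable (table_measure mu)"
  shows "(\<integral>\<^sup>+w. F w \<partial>table_measure mu)
    = (\<integral>\<^sup>+x. \<integral>\<^sup>+w. F (w((k, m, i) := x)) \<partial>table_measure mu \<partial>gauss (mu k m))"
proof -
  interpret T: prob_space "table_measure mu" by (rule prob_space_table_measure)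
  have [measurable]: "(\<lambda>z. F (case z of (x, w) \<Rightarrow> w((k, m, i) := x)))
      \<in> borel_measurable (gauss (mu k m) \<Otimes>\<^sub>M table_measure mu)"
    by (rule measurable_compose[OF measurable_table_upd F])
  have "(\<integral>\<^sup>+w. F w \<partial>table_measure mu)
      = (\<integral>\<^sup>+z. F (case z of (x, w) \<Rightarrow> w((k, m, i) := x)) \<partial>(gauss (mu k m) \<Otimes>\<^sub>M table_measure mu))"
    by (subst distr_table_upd[where k = k and m = m and i = i, symmetric])
       (intro nn_integral_distr measurable_table_upd, use F in simp)
  also have "\<dots> = (\<integral>\<^sup>+x. \<integral>\<^sup>+w. F (w((k, m, i) := x)) \<partial>table_measure mu \<partial>gauss (mu k m))"
    by (subst T.nn_integral_fst[symmetric]) auto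
  finally show ?thesis .
qed

lemma integral_table_upd:
  fixes F :: "table \<Rightarrow> real"
  assumes F: "F \<in> borel_measurable (table_measure mu)" and bd: "\<And>w. \<bar>F w\<bar> \<le> c"
  shows "(\<integral>w. F w \<partial>table_measure mu)
    = (\<integral>x. \<integral>w. F (w((k, m, i) := x)) \<partial>table_measure mu \<partial>gauss (mu k m))"
    and "(\<lambda>x. \<integral>w. F (w((k, m, i) := x)) \<partial>table_measure mu) \<in> borel_measurable borel"
proof -
  interpret T: prob_space "table_measure mu" by (rule prob_space_table_measure)
  interpret G: prob_space "gauss (mu k m)" by (rule prob_space_gauss)
  interpret P: pair_prob_space "gauss (mu k m)" "table_measure mu" ..
  have [measurable]: "(\<lambda>z. F (case z of (x, w) \<Rightarrow> w((k, m, i) := x)))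
      \<in> borel_measurable (gauss (mu k m) \<Otimes>\<^sub>M table_measure mu)"
    by (rule measurable_compose[OF measurable_table_upd F])
  then have int: "integrable (gauss (mu k m) \<Otimes>\<^sub>M table_measure mu)
      (\<lambda>(x, w). F (w((k, m, i) := x)))"
    using bd by (intro P.integrable_const_bound[where B = c]) (auto simp: split_beta)
  have "(\<integral>w. F w \<partial>table_measure mu)
      = (\<integral>z. F (case z of (x, w) \<Rightarrow> w((k, m, i) := x)) \<partial>(gauss (mu k m) \<Otimes>\<^sub>M table_measure mu))"
    by (subst distr_table_upd[where k = k and m = m and i = i, symmetric])
       (intro integral_distr measurable_table_upd, use F in simp)
  also have "\<dots> = (\<integral>x. \<integral>w. F (w((k, m, i) := x)) \<partial>table_measure mu \<partial>gauss (mu k m))"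
    using P.integral_fst[OF int] by (simp add: case_prod_unfold)
  finally show "(\<integral>w. F w \<partial>table_measure mu)
    = (\<integral>x. \<integral>w. F (w((k, m, i) := x)) \<partial>table_measure mu \<partial>gauss (mu k m))" .
  have "(\<lambda>x. \<integral>w. F (w((k, m, i) := x)) \<partial>table_measure mu) \<in> borel_measurable (gauss (mu k m))"
    by (rule T.borel_measurable_lebesgue_integral) (use int in auto)
  then show "(\<lambda>x. \<integral>w. F (w((k, m, i) := x)) \<partial>table_measure mu) \<in> borel_measurable borel"
    by simp
qed

subsection \<open>Histories and expected pull counts\<close>

lemma run_hist_after_stop:
  assumes "is_stop (alg u (run_hist alg u w t))" "t \<le> s"
  shows "run_hist alg u w s = run_hist alg u w t"
  using assms(2)
proof (induction s rule: dec_induct)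
  case (step s)
  then show ?case using assms(1) by (auto simp: is_stop_def Let_def split: action.splits)
qed simp

lemma length_run_hist_le: "length (run_hist alg u w t) \<le> t"
  by (induction t) (auto simp: Let_def split: action.splits)

lemma length_run_hist_le_stop_time: "of_nat (length (run_hist alg u w t)) \<le> stop_time alg u w"
proof (cases "stopped alg u w")
  case True
  define s where "s = first_stop alg u w"
  have s: "is_stop (alg u (run_hist alg u w s))"
    using True unfolding stopped_def s_def first_stop_def by (rule LeastI_ex)
  have "length (run_hist alg u w t) \<le> s"
  proof (cases "t \<le> s")
    case True
    then show ?thesis using length_run_hist_le[of alg u w t] by simp
  next
    case False
    then show ?thesis
      using run_hist_after_stop[of alg u w s t] s length_run_hist_le[of alg u w s] by simp
  qed
  then show ?thesis using True by (simp add: stop_time_def s_def)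
qed (simp add: stop_time_def)

abbreviation npulls :: "nat \<Rightarrow> nat \<Rightarrow> history \<Rightarrow> nat" where
  "npulls k m h \<equiv> length (filter (\<lambda>(k', m', _). k' = k \<and> m' = m) h)"

text \<open>Conditioning on the history \<^term>\<open>h\<close> without disintegration: \<^term>\<open>\<theta>\<close> overwrites the entries of a
  table that have been observed in \<^term>\<open>h\<close>, so that \<^term>\<open>\<theta> w\<close> has the conditional law when
  \<^term>\<open>w\<close> has the unconditional one.\<close>

definition replays :: "'r policy \<Rightarrow> 'r \<Rightarrow> history \<Rightarrow> (table \<Rightarrow> table) \<Rightarrow> bool" where
  "replays alg u h \<theta> \<longleftrightarrow>
     \<theta> \<in> PiM UNIV (\<lambda>_. borel) \<rightarrow>\<^sub>M PiM UNIV (\<lambda>_. borel) \<and>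
     (\<forall>w. run_hist alg u (\<theta> w) (length h) = h) \<and>
     (\<forall>w k m i x. npulls k m h \<le> i \<longrightarrow> \<theta> (w((k, m, i) := x)) = (\<theta> w)((k, m, i) := x))"

lemma replays_Nil: "replays alg u [] (\<lambda>w. w)"
  by (simp add: replays_def)

text \<open>The next pull reads entry \<open>npulls k m h\<close>, which \<open>h\<close> has not
  observed. Updating it therefore commutes with \<open>\<theta>\<close>, and the run reads exactly
  \<open>x\<close>.\<close>

lemma replays_pull:
  assumes r: "replays alg u h \<theta>" and p: "alg u h = Pull k m"
  shows "replays alg u (h @ [(k, m, x)]) (\<lambda>w. \<theta> (w((k, m, npulls k m h) := x)))"
  unfolding replays_def
proof (intro conjI allI impI)
  have "(\<lambda>w. w((k, m, npulls k m h) := x)) \<in> PiM UNIV (\<lambda>_. borel) \<rightarrow>\<^sub>M PiM UNIV (\<lambda>_. borel :: real measure)"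
    by (rule measurable_PiM_single') (auto simp: fun_upd_def space_PiM)
  then show "(\<lambda>w. \<theta> (w((k, m, npulls k m h) := x))) \<in> PiM UNIV (\<lambda>_. borel) \<rightarrow>\<^sub>M PiM UNIV (\<lambda>_. borel)"
    by (rule measurable_compose) (use r in \<open>auto simp: replays_def\<close>)
next
  fix w
  let ?w = "w((k, m, npulls k m h) := x)"
  have "\<theta> ?w = (\<theta> w)((k, m, npulls k m h) := x)"
    using r unfolding replays_def by blast
  moreover have "run_hist alg u (\<theta> ?w) (length h) = h"
    using r unfolding replays_def by blast
  ultimately show "run_hist alg u (\<theta> ?w) (length (h @ [(k, m, x)])) = h @ [(k, m, x)]"
    using p by (simp add: Let_def)
next
  fix w k' m' i y
  assume i: "npulls k' m' (h @ [(k, m, x)]) \<le> i"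
  \<comment> \<open>Appending the pull raised the count of \<open>(k, m)\<close> by one, so an index
    at or beyond the new count misses the entry just read.\<close>
  then have "(k', m', i) \<noteq> (k, m, npulls k m h)" "npulls k' m' h \<le> i" by auto
  then show "\<theta> ((w((k', m', i) := y))((k, m, npulls k m h) := x))
      = (\<theta> (w((k, m, npulls k m h) := x)))((k', m', i) := y)"
    using r by (subst fun_upd_twist) (auto simp: replays_def)
qed

text \<open>The policy need not be measurable, so the integrand below need not be either, and the
  integral is then a lower integral: it is superadditive, but not additive.\<close>

primrec exp_pulls ::
  "(nat \<Rightarrow> nat \<Rightarrow> real) \<Rightarrow> 'r policy \<Rightarrow> 'r \<Rightarrow> nat \<Rightarrow> nat \<Rightarrow> nat \<Rightarrow> history \<Rightarrow> ennreal" where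
  "exp_pulls mu alg u k m 0 h = 0"
| "exp_pulls mu alg u k m (Suc n) h = (case alg u h of
     Stop _ _ \<Rightarrow> 0
   | Pull k' m' \<Rightarrow> of_bool (k' = k \<and> m' = m) +
       (\<integral>\<^sup>+x. exp_pulls mu alg u k m n (h @ [(k', m', x)]) \<partial>gauss (mu k' m')))"

text \<open>The right side is the expected stopping time given \<open>h\<close>, and
  \<open>n\<close> caps the number of further steps. A pull lengthens the history by one and raises
  at most one count, while superadditivity moves the sums inside the lower integral.\<close>

lemma sum_exp_pulls_le_stop_time:
  assumes T: "stop_time alg u \<in> borel_measurable (PiM UNIV (\<lambda>_. borel))"
    and r: "replays alg u h \<theta>"
  shows "(\<Sum>k<K. \<Sum>m<M. exp_pulls mu alg u k m n h) + of_nat (length h)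
    \<le> (\<integral>\<^sup>+w. stop_time alg u (\<theta> w) \<partial>table_measure mu)"
proof -
  interpret P: prob_space "table_measure mu" by (rule prob_space_table_measure)
  have le: "of_nat (length h) \<le> (\<integral>\<^sup>+w. stop_time alg u (\<theta> w) \<partial>table_measure mu)"
    if "replays alg u h \<theta>" for h \<theta>
  proof -
    have "of_nat (length h) \<le> stop_time alg u (\<theta> w)" for w
      using that length_run_hist_le_stop_time[of alg u "\<theta> w" "length h"] by (simp add: replays_def)
    then have "(\<integral>\<^sup>+w. of_nat (length h) \<partial>table_measure mu) \<le> (\<integral>\<^sup>+w. stop_time alg u (\<theta> w) \<partial>table_measure mu)"
      by (intro nn_integral_mono)
    then show ?thesis using P.emeasure_space_1 by simp
  qed
  show ?thesis using r
  proof (induction n arbitrary: h \<theta>)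
    case 0
    then show ?case using le by simp
  next
    case (Suc n)
    show ?case
    proof (cases "alg u h")
      case (Stop l g)
      then show ?thesis using le[OF Suc.prems] by simp
    next
      case (Pull k0 m0)
      let ?E = "\<lambda>k m x. exp_pulls mu alg u k m n (h @ [(k0, m0, x)])"
      let ?G = "gauss (mu k0 m0)"
      interpret G: prob_space ?G by (rule prob_space_gauss)
      \<comment> \<open>At most one pair is pulled; a pull outside the index ranges counts as
        zero.\<close>
      have one: "(\<Sum>k<K. \<Sum>m<M. of_bool (k0 = k \<and> m0 = m)) \<le> (1::ennreal)"
      proof -
        have "(\<Sum>m<M. of_bool (k0 = k \<and> m0 = m)) = (if k0 = k then of_bool (m0 < M) else 0 :: ennreal)" for k
          by (auto simp: of_bool_def)
        then have "(\<Sum>k<K. \<Sum>m<M. of_bool (k0 = k \<and> m0 = m)) = (of_bool (k0 < K \<and> m0 < M) :: ennreal)"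
          by auto
        then show ?thesis by simp
      qed
      have "(\<Sum>k<K. \<Sum>m<M. exp_pulls mu alg u k m (Suc n) h) + of_nat (length h)
          = (\<Sum>k<K. \<Sum>m<M. of_bool (k0 = k \<and> m0 = m)) + (\<Sum>k<K. \<Sum>m<M. \<integral>\<^sup>+x. ?E k m x \<partial>?G) + of_nat (length h)"
        using Pull by (simp add: sum.distrib)
      also have "\<dots> \<le> 1 + (\<Sum>k<K. \<integral>\<^sup>+x. (\<Sum>m<M. ?E k m x) \<partial>?G) + of_nat (length h)"
        by (intro add_mono one order_refl sum_mono nn_integral_sum_superadditive)
      also have "\<dots> \<le> 1 + (\<integral>\<^sup>+x. (\<Sum>k<K. \<Sum>m<M. ?E k m x) \<partial>?G) + of_nat (length h)"
        by (intro add_mono order_refl nn_integral_sum_superadditive)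
      also have "\<dots> = (\<integral>\<^sup>+x. (\<Sum>k<K. \<Sum>m<M. ?E k m x) \<partial>?G) + (\<integral>\<^sup>+x. of_nat (Suc (length h)) \<partial>?G)"
        using G.emeasure_space_1 by (simp add: ac_simps)
      also have "\<dots> \<le> (\<integral>\<^sup>+x. (\<Sum>k<K. \<Sum>m<M. ?E k m x) + of_nat (Suc (length h)) \<partial>?G)"
        by (rule nn_integral_superadditive)
      also have "\<dots> \<le> (\<integral>\<^sup>+x. \<integral>\<^sup>+w. stop_time alg u (\<theta> (w((k0, m0, npulls k0 m0 h) := x))) \<partial>table_measure mu \<partial>?G)"
      proof (rule nn_integral_mono)
        fix x
        show "(\<Sum>k<K. \<Sum>m<M. ?E k m x) + of_nat (Suc (length h))
          \<le> (\<integral>\<^sup>+w. stop_time alg u (\<theta> (w((k0, m0, npulls k0 m0 h) := x))) \<partial>table_measure mu)"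
          using Suc.IH[OF replays_pull[OF Suc.prems Pull, of x]] by (simp del: fun_upd_apply)
      qed
      \<comment> \<open>The resampling identity folds the observed reward back into the table; the
        integrand here is measurable by \<open>T\<close>.\<close>
      also have "\<dots> = (\<integral>\<^sup>+w. stop_time alg u (\<theta> w) \<partial>table_measure mu)"
      proof (rule nn_integral_table_upd[symmetric])
        show "(\<lambda>w. stop_time alg u (\<theta> w)) \<in> borel_measurable (table_measure mu)"
          unfolding measurable_table_measure
          by (rule measurable_compose[OF _ T]) (use Suc.prems in \<open>simp add: replays_def\<close>)
      qed
      finally show ?thesis .
    qed
  qed
qed

text \<open>Truncation at 0 keeps the inequality when a summand is negative, where equality can
  fail.\<close>

lemma ennreal_add_le: "ennreal (x + y) \<le> ennreal x + ennreal y"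
proof (cases "0 \<le> x \<and> 0 \<le> y")
  case False
  then consider "x < 0" | "y < 0" by linarith
  then show ?thesis
  proof cases
    case 1 then show ?thesis by (simp add: ennreal_neg ennreal_leI)
  next
    case 2 then show ?thesis by (simp add: ennreal_neg ennreal_leI)
  qed
qed simp

subsection \<open>Change of measure\<close>

text \<open>A Donsker--Varadhan bound conditional on the history. The per-step slack \<^term>\<open>e\<close> absorbs the
  changes of all means but one; it is not weighted by pull counts because lower integrals are not
  subadditive.\<close>

lemma change_of_measure:
  fixes \<beta> :: "history \<Rightarrow> real"
  assumes B: "(\<lambda>w. \<beta> (run_hist alg u w N)) \<in> borel_measurable (PiM UNIV (\<lambda>_. borel))"
    and bd: "\<And>h. \<bar>\<beta> h\<bar> \<le> c"
    and valid: "valid_policy K M alg"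
    and \<kappa>: "0 < \<kappa>" "(mu' k0 m0 - mu k0 m0)\<^sup>2 / 2 \<le> \<kappa>"
    and e: "0 \<le> e" "\<And>k m. k < K \<Longrightarrow> m < M \<Longrightarrow> \<not> (k = k0 \<and> m = m0) \<Longrightarrow> (mu' k m - mu k m)\<^sup>2 / 2 \<le> e"
    and r: "replays alg u h \<theta>" and N: "length h + n = N"
  shows "ennreal (((\<integral>w. \<beta> (run_hist alg u (\<theta> w) N) \<partial>table_measure mu)
      - ln (\<integral>w. exp (\<beta> (run_hist alg u (\<theta> w) N)) \<partial>table_measure mu') - real n * e) / \<kappa>)
    \<le> exp_pulls mu alg u k0 m0 n h"
proof -
  interpret P: prob_space "table_measure mu" by (rule prob_space_table_measure)
  interpret P': prob_space "table_measure mu'" by (rule prob_space_table_measure)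
  \<comment> \<open>When the run up to \<open>N\<close> is already fixed, both integrands are
    constant and the two main terms cancel, which leaves a nonpositive number that
    \<open>ennreal\<close> sends to 0.\<close>
  have decided: "ennreal (((\<integral>w. \<beta> (run_hist alg u (\<theta> w) N) \<partial>table_measure mu)
      - ln (\<integral>w. exp (\<beta> (run_hist alg u (\<theta> w) N)) \<partial>table_measure mu') - real n * e) / \<kappa>) = 0"
    if "\<And>w. run_hist alg u (\<theta> w) N = h" for h \<theta> n
    using that e(1) \<kappa>(1) P.prob_space P'.prob_space
    by (auto intro!: ennreal_neg divide_nonpos_pos)
  show ?thesis using r N
  proof (induction n arbitrary: h \<theta>)
    case 0
    then show ?case by (subst decided[of \<theta> h]) (auto simp: replays_def)
  next
    case (Suc n)
    show ?case
    proof (cases "alg u h")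
      case (Stop l g)
      have "run_hist alg u (\<theta> w) N = h" for w
        using run_hist_after_stop[of alg u "\<theta> w" "length h" N] Suc.prems Stop
        by (simp add: replays_def is_stop_def)
      then show ?thesis by (subst decided) auto
    next
      case (Pull k m)
      then have km: "k < K" "m < M" using valid by (auto simp: valid_policy_def)
      let ?G = "gauss (mu k m)" and ?c = "(k, m, npulls k m h)"
      interpret G: prob_space ?G by (rule prob_space_gauss)
      interpret G': prob_space "gauss (mu' k m)" by (rule prob_space_gauss)
      define B where "B = (\<lambda>w. \<beta> (run_hist alg u (\<theta> w) N))"
      have Bm: "B \<in> borel_measurable (PiM UNIV (\<lambda>_. borel))"
        unfolding B_def by (rule measurable_compose[OF _ B]) (use Suc.prems in \<open>simp add: replays_def\<close>)
      have Bbd: "\<bar>B w\<bar> \<le> c" for w using bd by (simp add: B_def)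
      have Bm1: "B \<in> borel_measurable (table_measure mu)"
        and Bm2: "(\<lambda>w. exp (B w)) \<in> borel_measurable (table_measure mu')"
        using Bm by (auto simp: measurable_table_measure)
      have eBbd: "\<bar>exp (B w)\<bar> \<le> exp c" for w using Bbd[of w] by simp
      \<comment> \<open>\<open>f x\<close> and \<open>Z x\<close> are the two integrals of the claim
        after reward \<open>x\<close> has been observed, hence those of the induction hypothesis for
        the extended history.\<close>
      define f where "f = (\<lambda>x. \<integral>w. B (w(?c := x)) \<partial>table_measure mu)"
      define Z where "Z = (\<lambda>x. \<integral>w. exp (B (w(?c := x))) \<partial>table_measure mu')"
      have fint: "(\<integral>w. B w \<partial>table_measure mu) = (\<integral>x. f x \<partial>?G)"
        and [measurable]: "f \<in> borel_measurable borel"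
        unfolding f_def using integral_table_upd[OF Bm1 Bbd] by blast+
      have Zint: "(\<integral>w. exp (B w) \<partial>table_measure mu') = (\<integral>x. Z x \<partial>gauss (mu' k m))"
        and [measurable]: "Z \<in> borel_measurable borel"
        unfolding Z_def using integral_table_upd[OF Bm2 eBbd] by blast+
      have upd1: "(\<lambda>w. B (w(?c := x))) \<in> borel_measurable (table_measure mu)" for x
        by (rule measurable_compose[OF measurable_table_upd' Bm1])
      have upd2: "(\<lambda>w. exp (B (w(?c := x)))) \<in> borel_measurable (table_measure mu')" for x
        by (rule measurable_compose[OF measurable_table_upd' Bm2])
      have fbd: "\<bar>f x\<bar> \<le> c" for x
      proof -
        have int: "integrable (table_measure mu) (\<lambda>w. B (w(?c := x)))"
          using Bbd upd1 by (intro P.integrable_const_bound[where B = c]) auto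
        show ?thesis unfolding f_def abs_le_iff
          using int Bbd by (auto intro!: P.integral_ge_const P.integral_le_const simp: abs_le_iff minus_le_iff
            integral_minus[symmetric] simp del: integral_minus)
      qed
      have Zbd: "exp (- c) \<le> Z x" "Z x \<le> exp c" for x
      proof -
        have int: "integrable (table_measure mu') (\<lambda>w. exp (B (w(?c := x))))"
          using eBbd upd2 by (intro P'.integrable_const_bound[where B = "exp c"]) auto
        have "- c \<le> B w" "B w \<le> c" for w using Bbd[of w] by auto
        then show "exp (- c) \<le> Z x" "Z x \<le> exp c" unfolding Z_def
          using int by (auto intro!: P'.integral_ge_const P'.integral_le_const)
      qed
      have Zpos: "0 < Z x" for x using Zbd(1)[of x] by (rule less_le_trans[OF exp_gt_zero])
      have lnZ: "\<bar>ln (Z x)\<bar> \<le> c" for x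
      proof -
        have "ln (exp (- c)) \<le> ln (Z x)" "ln (Z x) \<le> ln (exp c)"
          using Zbd[of x] Zpos[of x] by (simp_all only: ln_le_cancel_iff exp_gt_zero)
        then show ?thesis by simp
      qed
      have fi: "integrable ?G f"
        using fbd by (intro G.integrable_const_bound[where B = c]) auto
      have li: "integrable ?G (\<lambda>x. ln (Z x))"
        using lnZ by (intro G.integrable_const_bound[where B = c]) auto
      define q where "q = (mu' k m - mu k m)\<^sup>2 / 2"
      \<comment> \<open>Donsker--Varadhan for this single reward, with test function
        \<open>ln (Z x)\<close>; \<open>q\<close> is the relative entropy spent on the pull.\<close>
      have "(\<integral>x. ln (Z x) \<partial>?G) - q \<le> ln (\<integral>x. exp (ln (Z x)) \<partial>gauss (mu' k m))"
        unfolding q_def by (rule gauss_ln_integral_exp[where c = c]) (use lnZ in auto)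
      then have gl: "(\<integral>x. ln (Z x) \<partial>?G) - q \<le> ln (\<integral>x. Z x \<partial>gauss (mu' k m))"
        using Zpos by simp
      define I :: real where "I = of_bool (k = k0 \<and> m = m0)"
      \<comment> \<open>A pull of the target pair costs at most \<open>\<kappa>\<close> and is paid
        for by the count; any other pull costs at most \<open>e\<close> and is paid for by the
        slack.\<close>
      have qI: "(q - e) / \<kappa> \<le> I"
        using \<kappa> e km unfolding q_def I_def by (cases "k = k0 \<and> m = m0") (auto simp: field_simps)
      have ii: "integrable ?G (\<lambda>x. (f x - ln (Z x) - real n * e) / \<kappa>)"
        using fi li by auto
      have "((\<integral>w. B w \<partial>table_measure mu) - ln (\<integral>w. exp (B w) \<partial>table_measure mu') - real (Suc n) * e) / \<kappa>
          \<le> ((\<integral>x. f x \<partial>?G) - (\<integral>x. ln (Z x) \<partial>?G) - real n * e + (q - e)) / \<kappa>"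
        unfolding fint Zint using gl \<kappa>(1) by (intro divide_right_mono) (auto simp: algebra_simps)
      also have "\<dots> = (q - e) / \<kappa> + ((\<integral>x. f x \<partial>?G) - (\<integral>x. ln (Z x) \<partial>?G) - real n * e) / \<kappa>"
        by (simp add: add_divide_distrib)
      also have "\<dots> \<le> I + (\<integral>x. (f x - ln (Z x) - real n * e) / \<kappa> \<partial>?G)"
        using qI fi li G.prob_space by (simp add: Bochner_Integration.integral_diff)
      finally have "ennreal (((\<integral>w. B w \<partial>table_measure mu) - ln (\<integral>w. exp (B w) \<partial>table_measure mu') - real (Suc n) * e) / \<kappa>)
          \<le> ennreal (I + (\<integral>x. (f x - ln (Z x) - real n * e) / \<kappa> \<partial>?G))"
        by (rule ennreal_leI)
      also have "\<dots> \<le> ennreal I + ennreal (\<integral>x. (f x - ln (Z x) - real n * e) / \<kappa> \<partial>?G)"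
        by (rule ennreal_add_le)
      also have "\<dots> \<le> ennreal I + (\<integral>\<^sup>+x. ennreal ((f x - ln (Z x) - real n * e) / \<kappa>) \<partial>?G)"
        by (intro add_left_mono ennreal_integral_le_nn_integral ii)
      also have "\<dots> \<le> ennreal I + (\<integral>\<^sup>+x. exp_pulls mu alg u k0 m0 n (h @ [(k, m, x)]) \<partial>?G)"
      proof (intro add_left_mono nn_integral_mono)
        fix x
        show "ennreal ((f x - ln (Z x) - real n * e) / \<kappa>) \<le> exp_pulls mu alg u k0 m0 n (h @ [(k, m, x)])"
          using Suc.IH[OF replays_pull[OF Suc.prems(1) Pull, of x]] Suc.prems(2)
          by (simp add: f_def Z_def B_def del: fun_upd_apply)
      qed
      also have "\<dots> = exp_pulls mu alg u k0 m0 (Suc n) h"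
        using Pull by (simp add: I_def of_bool_def)
      finally show ?thesis unfolding B_def .
    qed
  qed
qed

section \<open>Correct answers by a fixed time and averaging over the internal randomness\<close>

text \<open>Correctness of a single action, so that it can be asked of the run at a fixed time
  instead of at \<open>first_stop\<close>.\<close>

definition answers :: "(nat \<Rightarrow> nat \<Rightarrow> real) \<Rightarrow> nat \<Rightarrow> nat \<Rightarrow> action \<Rightarrow> bool" where
  "answers mu K M a \<longleftrightarrow> (case a of
     Stop loc g \<Rightarrow> (\<forall>m<M. loc m = local_best mu K m) \<and> g = global_best mu K M
   | Pull _ _ \<Rightarrow> False)"

text \<open>The history is frozen after stopping, so the action at time \<open>n\<close> is the
  final output once the policy has stopped, and a \<open>Pull\<close> before that.\<close>

lemma answers_run_hist_iff:
  "answers mu K M (alg u (run_hist alg u w n))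
    \<longleftrightarrow> correct_output mu K M alg u w \<and> stop_time alg u w \<le> of_nat n" (is "?L \<longleftrightarrow> ?R")
proof -
  have eq: "run_hist alg u w n = run_hist alg u w (first_stop alg u w)"
    if "stopped alg u w" "first_stop alg u w \<le> n"
  proof -
    have "is_stop (alg u (run_hist alg u w (first_stop alg u w)))"
      using that(1) unfolding stopped_def first_stop_def by (rule LeastI_ex)
    then show ?thesis using run_hist_after_stop that(2) by metis
  qed
  show ?thesis
  proof
    assume L: ?L
    then have s: "is_stop (alg u (run_hist alg u w n))"
      by (auto simp: answers_def is_stop_def split: action.splits)
    then have st: "stopped alg u w" by (auto simp: stopped_def)
    have "first_stop alg u w \<le> n" unfolding first_stop_def using s by (rule Least_le)
    then show ?R using L st eq
      by (simp add: correct_output_def answers_def alg_output_def stop_time_def)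
  next
    assume R: ?R
    then have st: "stopped alg u w" by (simp add: correct_output_def)
    then have "first_stop alg u w \<le> n" using R by (simp add: stop_time_def)
    then show ?L using R st eq
      by (simp add: correct_output_def answers_def alg_output_def)
  qed
qed

text \<open>The test function is \<open>a\<close> times the indicator of \<open>S\<close>, whose
  exponential is affine in that indicator; both integrals thus become probabilities of
  \<open>S\<close>. The conditional bound is applied for each \<open>u\<close> to the empty history
  and then averaged.\<close>

lemma change_of_measure_model:
  assumes R: "prob_space R" and valid: "valid_policy K M alg"
    and S: "S = {x \<in> space (model R mu). ok (alg (fst x) (run_hist alg (fst x) (snd x) N))}"
    and Sm: "S \<in> sets (model R mu)"
    and \<kappa>: "0 < \<kappa>" "(mu' k0 m0 - mu k0 m0)\<^sup>2 / 2 \<le> \<kappa>"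
    and e: "0 \<le> e" "\<And>k m. k < K \<Longrightarrow> m < M \<Longrightarrow> \<not> (k = k0 \<and> m = m0) \<Longrightarrow> (mu' k m - mu k m)\<^sup>2 / 2 \<le> e"
    and a: "0 \<le> a"
  shows "ennreal ((a * measure (model R mu) S
      - ln (1 + (exp a - 1) * measure (model R mu') S) - real N * e) / \<kappa>)
    \<le> (\<integral>\<^sup>+u. exp_pulls mu alg u k0 m0 N [] \<partial>R)"
proof -
  interpret R: prob_space R by fact
  interpret T: prob_space "table_measure mu" by (rule prob_space_table_measure)
  interpret T': prob_space "table_measure mu'" by (rule prob_space_table_measure)
  interpret P: pair_prob_space R "table_measure mu" ..
  interpret P': pair_prob_space R "table_measure mu'" ..
  define \<beta> where "\<beta> = (\<lambda>u h. if ok (alg u h) then a else 0)"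
  have Sm1 [measurable]: "S \<in> sets (R \<Otimes>\<^sub>M table_measure mu)"
    using Sm by (simp add: model_eq)
  have Sm2 [measurable]: "S \<in> sets (R \<Otimes>\<^sub>M table_measure mu')"
    using Sm1 sets_model[of R mu mu'] unfolding model_eq by blast
  have \<beta>S: "\<beta> u (run_hist alg u w N) = a * indicator S (u, w)" if "u \<in> space R" for u w
    using that by (auto simp: \<beta>_def S model_eq space_pair_measure)
  define F where "F = (\<lambda>u w. a * indicator S (u, w))"
  have Fbd: "0 \<le> F u w" "F u w \<le> a" for u w
    using a by (auto simp: F_def indicator_def)
  have [measurable]: "(\<lambda>(u, w). F u w) \<in> borel_measurable (R \<Otimes>\<^sub>M table_measure mu)"
    unfolding F_def by measurable
  have [measurable]: "(\<lambda>(u, w). F u w) \<in> borel_measurable (R \<Otimes>\<^sub>M table_measure mu')"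
    unfolding F_def by measurable
  have i1: "integrable (R \<Otimes>\<^sub>M table_measure mu) (\<lambda>(u, w). F u w)"
    using Fbd a by (intro P.integrable_const_bound[where B = a]) auto
  have i2: "integrable (R \<Otimes>\<^sub>M table_measure mu') (\<lambda>(u, w). exp (F u w))"
    using Fbd a by (intro P'.integrable_const_bound[where B = "exp a"]) auto
  define f where "f = (\<lambda>u. \<integral>w. F u w \<partial>table_measure mu)"
  define Z where "Z = (\<lambda>u. \<integral>w. exp (F u w) \<partial>table_measure mu')"
  have fint: "(\<integral>u. f u \<partial>R) = a * measure (model R mu) S"
  proof -
    have "(\<integral>u. f u \<partial>R) = (\<integral>(u, w). F u w \<partial>(R \<Otimes>\<^sub>M table_measure mu))"
      unfolding f_def by (rule P.integral_fst[OF i1])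
    also have "\<dots> = a * measure (model R mu) S"
      using sets.sets_into_space[OF Sm1]
      by (simp add: F_def model_eq case_prod_unfold Int_absorb2)
    finally show ?thesis .
  qed
  have Zint: "(\<integral>u. Z u \<partial>R) = 1 + (exp a - 1) * measure (model R mu') S"
  proof -
    have ex: "exp (F u w) = 1 + (exp a - 1) * indicator S (u, w)" for u w
      by (auto simp: F_def indicator_def)
    have "(\<integral>u. Z u \<partial>R) = (\<integral>(u, w). exp (F u w) \<partial>(R \<Otimes>\<^sub>M table_measure mu'))"
      unfolding Z_def by (rule P'.integral_fst[OF i2])
    also have "\<dots> = 1 + (exp a - 1) * measure (model R mu') S"
    proof -
      have "integrable (R \<Otimes>\<^sub>M table_measure mu') (indicat_real S)"
        by (intro integrable_real_indicator Sm2) (simp add: P'.emeasure_eq_measure)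
      then show ?thesis
        unfolding ex using sets.sets_into_space[OF Sm2] P'.prob_space
        by (simp add: model_eq case_prod_unfold Int_absorb2)
    qed
    finally show ?thesis .
  qed
  have [measurable]: "f \<in> borel_measurable R" "Z \<in> borel_measurable R"
    unfolding f_def Z_def by measurable
  have fbd: "\<bar>f u\<bar> \<le> a" and Zbd: "1 \<le> Z u" "Z u \<le> exp a" if "u \<in> space R" for u
  proof -
    have "F u \<in> borel_measurable (table_measure mu)" "F u \<in> borel_measurable (table_measure mu')"
      using that by measurable
    then have ii: "integrable (table_measure mu) (F u)" "integrable (table_measure mu') (\<lambda>w. exp (F u w))"
      using Fbd by (auto intro!: T.integrable_const_bound[where B = a] T'.integrable_const_bound[where B = "exp a"])
    have "0 \<le> f u" "f u \<le> a" unfolding f_def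
      using Fbd ii by (auto intro!: T.integral_ge_const T.integral_le_const)
    then show "\<bar>f u\<bar> \<le> a" by simp
    show "1 \<le> Z u" "Z u \<le> exp a" unfolding Z_def
      using Fbd ii by (auto intro!: T'.integral_ge_const T'.integral_le_const)
  qed
  have lnZ: "\<bar>ln (Z u)\<bar> \<le> a" if "u \<in> space R" for u
  proof -
    have "ln (Z u) \<le> ln (exp a)"
      using Zbd[OF that] by (simp only: ln_le_cancel_iff exp_gt_zero)
    then show ?thesis using Zbd[OF that] by simp
  qed
  have fi: "integrable R f"
    using fbd by (intro R.integrable_const_bound[where B = a]) auto
  have li: "integrable R (\<lambda>u. ln (Z u))"
    using lnZ by (intro R.integrable_const_bound[where B = a]) auto
  have Zi: "integrable R Z"
    using Zbd by (intro R.integrable_const_bound[where B = "exp a"]) (auto intro!: AE_I2 simp: abs_le_iff, smt)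
  have eZ: "exp (ln (Z u)) = Z u" if "u \<in> space R" for u
    using Zbd(1)[OF that] by simp
  \<comment> \<open>The internal randomness has the same law under both instances, so averaging over
    it costs only another use of Jensen.\<close>
  have "(\<integral>u. ln (Z u) \<partial>R) \<le> ln (\<integral>u. exp (ln (Z u)) \<partial>R)"
    by (rule R.integral_le_ln_integral_exp[OF li])
       (use Zi eZ in \<open>simp cong: Bochner_Integration.integrable_cong\<close>)
  also have "(\<integral>u. exp (ln (Z u)) \<partial>R) = (\<integral>u. Z u \<partial>R)"
    using eZ by (rule Bochner_Integration.integral_cong[OF refl])
  finally have jensen: "(\<integral>u. ln (Z u) \<partial>R) \<le> ln (\<integral>u. Z u \<partial>R)" .
  have "(a * measure (model R mu) S - ln (1 + (exp a - 1) * measure (model R mu') S) - real N * e) / \<kappa>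
      \<le> ((\<integral>u. f u \<partial>R) - (\<integral>u. ln (Z u) \<partial>R) - real N * e) / \<kappa>"
    using jensen \<kappa>(1) unfolding fint[symmetric] Zint[symmetric] by (intro divide_right_mono) auto
  also have "\<dots> = (\<integral>u. (f u - ln (Z u) - real N * e) / \<kappa> \<partial>R)"
    using fi li R.prob_space by simp
  finally have "ennreal ((a * measure (model R mu) S
      - ln (1 + (exp a - 1) * measure (model R mu') S) - real N * e) / \<kappa>)
      \<le> ennreal (\<integral>u. (f u - ln (Z u) - real N * e) / \<kappa> \<partial>R)"
    by (rule ennreal_leI)
  also have "\<dots> \<le> (\<integral>\<^sup>+u. ennreal ((f u - ln (Z u) - real N * e) / \<kappa>) \<partial>R)"
    using fi li by (intro ennreal_integral_le_nn_integral) auto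
  also have "\<dots> \<le> (\<integral>\<^sup>+u. exp_pulls mu alg u k0 m0 N [] \<partial>R)"
  proof (rule nn_integral_mono)
    fix u assume u: "u \<in> space R"
    have "F u \<in> borel_measurable (table_measure mu)" using u by measurable
    then have "(\<lambda>w. \<beta> u (run_hist alg u w N)) \<in> borel_measurable (PiM UNIV (\<lambda>_. borel))"
      using u by (simp add: \<beta>S F_def measurable_table_measure)
    then have "ennreal (((\<integral>w. \<beta> u (run_hist alg u w N) \<partial>table_measure mu)
        - ln (\<integral>w. exp (\<beta> u (run_hist alg u w N)) \<partial>table_measure mu') - real N * e) / \<kappa>)
        \<le> exp_pulls mu alg u k0 m0 N []"
      using a by (intro change_of_measure[where \<theta> = "\<lambda>w. w" and c = a] valid \<kappa> e replays_Nil)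
        (auto simp: \<beta>_def valid)
    then show "ennreal ((f u - ln (Z u) - real N * e) / \<kappa>) \<le> exp_pulls mu alg u k0 m0 N []"
      using u by (simp add: \<beta>S f_def Z_def F_def)
  qed
  finally show ?thesis .
qed

subsection \<open>Alternative instances\<close>

lemma strict_max_exists:
  fixes f :: "nat \<Rightarrow> real"
  assumes "0 < K" "inj_on f {..<K}"
  shows "\<exists>k<K. \<forall>j<K. j \<noteq> k \<longrightarrow> f j < f k"
proof -
  have "Max (f ` {..<K}) \<in> f ` {..<K}" using assms(1) by (intro Max_in) auto
  then obtain k where k: "k < K" "f k = Max (f ` {..<K})" by auto
  have "f j < f k" if "j < K" "j \<noteq> k" for j
  proof -
    have "f j \<le> f k" using that k by simp
    moreover have "f j \<noteq> f k" using assms(2) that k by (auto simp: inj_on_def)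
    ultimately show ?thesis by simp
  qed
  with k show ?thesis by blast
qed

lemma global_mean_add:
  assumes "0 < M"
  shows "global_mean (\<lambda>k m. f k m + c k) M k = global_mean f M k + c k"
  using assms by (simp add: global_mean_def sum.distrib add_divide_distrib)

text \<open>Instances with unique best arms are dense: a tilt by a generic multiple of the arm index
  removes all ties. Raising row \<^term>\<open>j\<close> first turns weak dominance of \<^term>\<open>j\<close> into a strict one.\<close>

lemma unique_bests_perturbation:
  fixes nu :: "nat \<Rightarrow> nat \<Rightarrow> real"
  assumes "0 < K" "0 < M" "0 < \<eta>" "j < K"
  obtains mu' where "unique_bests mu' K M"
    and "\<And>k m. k < K \<Longrightarrow> \<bar>mu' k m - nu k m\<bar> \<le> 2 * \<eta>"
    and "\<And>b m. b < K \<Longrightarrow> b \<noteq> j \<Longrightarrow> nu b m \<le> nu j m \<Longrightarrow> mu' b m < mu' j m"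
    and "\<And>b. b < K \<Longrightarrow> b \<noteq> j \<Longrightarrow> global_mean nu M b \<le> global_mean nu M j
      \<Longrightarrow> global_mean mu' M b < global_mean mu' M j"
proof -
  define r where "r = (\<lambda>k m. nu k m + (if k = j then \<eta> else 0))"
  define g where "g = global_mean r M"
  \<comment> \<open>The tilts \<open>t\<close> that create a tie for some client or between global
    means; pairs with \<open>k = k'\<close> only contribute 0, by division by zero.\<close>
  define bad where "bad =
    (\<lambda>(k, k', m). (r k' m - r k m) / (real k - real k')) ` ({..<K} \<times> {..<K} \<times> {..<M}) \<union>
    (\<lambda>(k, k'). (g k' - g k) / (real k - real k')) ` ({..<K} \<times> {..<K})"
  have "finite bad" unfolding bad_def by auto
  moreover have "infinite {0<..<\<eta> / real K}" using assms by (intro infinite_Ioo) auto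
  ultimately obtain t where t: "t \<in> {0<..<\<eta> / real K}" "t \<notin> bad"
    by (meson finite_subset subsetI)
  define mu' where "mu' = (\<lambda>k m. r k m + t * real k)"
  \<comment> \<open>The tilt stays below \<open>\<eta>\<close>, so it cannot undo the raise of row
    \<open>j\<close>, and the total displacement stays within \<open>2 * \<eta>\<close>.\<close>
  have tK: "0 \<le> t * real k" "t * real k < \<eta>" if "k < K" for k
  proof -
    show "0 \<le> t * real k" using t by simp
    have "t * real k \<le> t * real K" using t that by (intro mult_left_mono) auto
    also have "\<dots> < \<eta>" using t(1) assms by (simp add: field_simps)
    finally show "t * real k < \<eta>" .
  qed
  have gm: "global_mean mu' M k = g k + t * real k" for k
    unfolding mu'_def g_def by (rule global_mean_add[OF assms(2)])
  have gr: "g k = global_mean nu M k + (if k = j then \<eta> else 0)" for k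
    unfolding r_def g_def by (rule global_mean_add[OF assms(2)])
  have tie: "t = (y - x) / (real k - real k')" if "x + t * real k = y + t * real k'" "k \<noteq> k'" for x y k k'
    using that by (simp add: field_simps)
  have "inj_on (\<lambda>k. mu' k m) {..<K}" if "m < M" for m
  proof (rule inj_onI, rule ccontr)
    fix k k' assume *: "k \<in> {..<K}" "k' \<in> {..<K}" "mu' k m = mu' k' m" "k \<noteq> k'"
    then have "t = (r k' m - r k m) / (real k - real k')"
      by (intro tie) (auto simp: mu'_def)
    then have "t \<in> bad" using * that unfolding bad_def by (force simp: image_iff)
    then show False using t(2) by simp
  qed
  then have "\<exists>k. is_local_best mu' K m k" if "m < M" for m
    using strict_max_exists[OF assms(1)] that by (simp add: is_local_best_def)
  moreover have "inj_on (global_mean mu' M) {..<K}"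
  proof (rule inj_onI, rule ccontr)
    fix k k' assume *: "k \<in> {..<K}" "k' \<in> {..<K}" "global_mean mu' M k = global_mean mu' M k'" "k \<noteq> k'"
    then have "t = (g k' - g k) / (real k - real k')"
      by (intro tie) (auto simp: gm)
    then have "t \<in> bad" using * unfolding bad_def by (force simp: image_iff)
    then show False using t(2) by simp
  qed
  then have "\<exists>k. is_global_best mu' K M k"
    using strict_max_exists[OF assms(1)] by (simp add: is_global_best_def)
  ultimately have "unique_bests mu' K M" by (simp add: unique_bests_def)
  moreover have "\<bar>mu' k m - nu k m\<bar> \<le> 2 * \<eta>" if "k < K" for k m
    using tK[OF that] assms(3) by (auto simp: mu'_def r_def)
  moreover have "mu' b m < mu' j m" if "b < K" "b \<noteq> j" "nu b m \<le> nu j m" for b m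
    using tK[OF that(1)] tK[OF assms(4)] that unfolding mu'_def r_def by simp
  moreover have "global_mean mu' M b < global_mean mu' M j"
    if "b < K" "b \<noteq> j" "global_mean nu M b \<le> global_mean nu M j" for b
    using tK[OF that(1)] tK[OF assms(4)] that unfolding gm gr by simp
  ultimately show ?thesis by (rule that)
qed

section \<open>Gaps as displacements of a single mean\<close>

lemma is_local_best_local_best:
  assumes "unique_bests mu K M" "m < M"
  shows "is_local_best mu K m (local_best mu K m)"
proof -
  obtain k where k: "is_local_best mu K m k" using assms by (auto simp: unique_bests_def)
  then show ?thesis unfolding local_best_def
    by (rule theI) (metis is_local_best_def k less_asym)
qed

lemma is_global_best_global_best:
  assumes "unique_bests mu K M"
  shows "is_global_best mu K M (global_best mu K M)"
proof -
  obtain k where k: "is_global_best mu K M k" using assms by (auto simp: unique_bests_def)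
  then show ?thesis unfolding global_best_def
    by (rule theI) (metis is_global_best_def k less_asym)
qed

text \<open>If \<open>k\<close> is the best arm \<open>b\<close>, it is lowered to the level of a
  runner-up \<open>j\<close>. Otherwise \<open>k\<close> itself is raised to the level of
  \<open>b\<close> and \<open>j = k\<close>. The minimum in the gap of the best arm is thus the size
  of a shift as well.\<close>

lemma gap_as_shift:
  fixes f :: "nat \<Rightarrow> real"
  assumes "1 < K" "b < K" "\<And>j. j < K \<Longrightarrow> j \<noteq> b \<Longrightarrow> f j < f b" "k < K"
  obtains s j where "\<bar>s\<bar> = (if k = b then Min {f b - f j | j. j < K \<and> j \<noteq> b} else f b - f k)"
    and "s \<noteq> 0" and "j < K" and "j \<noteq> b"
    and "f b + (if b = k then s else 0) \<le> f j + (if j = k then s else 0)"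
proof (cases "k = b")
  case True
  let ?D = "{f b - f j | j. j < K \<and> j \<noteq> b}"
  have "(if b = 0 then 1 else 0) < K" "(if b = 0 then 1 else 0) \<noteq> b" using assms(1) by auto
  then have "?D \<noteq> {}" by blast
  moreover have "finite ?D" by simp
  ultimately have "Min ?D \<in> ?D" by (rule Min_in[rotated])
  then obtain j where j: "Min ?D = f b - f j" "j < K" "j \<noteq> b" by blast
  show ?thesis
    by (rule that[of "f j - f b" j]) (use j True assms(3)[of j] in auto)
next
  case False
  show ?thesis
    by (rule that[of "f b - f k" k]) (use False assms(3)[of k] assms(4) in auto)
qed

abbreviation shift :: "(nat \<Rightarrow> nat \<Rightarrow> real) \<Rightarrow> nat \<Rightarrow> nat \<Rightarrow> real \<Rightarrow> nat \<Rightarrow> nat \<Rightarrow> real" where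
  "shift mu k0 m0 s \<equiv> (\<lambda>k m. mu k m + (if k = k0 \<and> m = m0 then s else 0))"

lemma global_mean_shift:
  assumes "m0 < M"
  shows "global_mean (shift mu k0 m0 s) M k = global_mean mu M k + (if k = k0 then s else 0) / real M"
  using assms by (auto simp: global_mean_def sum.distrib add_divide_distrib sum.If_cases)

lemma gap_loc_shift:
  assumes "1 < K" "unique_bests mu K M" "k < K" "m < M"
  obtains s j where "\<bar>s\<bar> = gap_loc mu K k m" "s \<noteq> 0" "j < K" "j \<noteq> local_best mu K m"
    "shift mu k m s (local_best mu K m) m \<le> shift mu k m s j m"
proof -
  let ?b = "local_best mu K m"
  have b: "?b < K" "\<And>j. j < K \<Longrightarrow> j \<noteq> ?b \<Longrightarrow> mu j m < mu ?b m"
    using is_local_best_local_best[OF assms(2,4)] by (auto simp: is_local_best_def)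
  show ?thesis
  proof (rule gap_as_shift[where f = "\<lambda>k. mu k m", OF assms(1) b assms(3)])
    fix s j
    assume "\<bar>s\<bar> = (if k = ?b then Min {mu ?b m - mu j m | j. j < K \<and> j \<noteq> ?b} else mu ?b m - mu k m)"
      and j: "s \<noteq> 0" "j < K" "j \<noteq> ?b"
      and le: "mu ?b m + (if ?b = k then s else 0) \<le> mu j m + (if j = k then s else 0)"
    then have "\<bar>s\<bar> = gap_loc mu K k m" by (simp add: gap_loc_def Let_def)
    moreover have "shift mu k m s ?b m \<le> shift mu k m s j m" using le by simp
    ultimately show thesis using j by (intro that)
  qed
qed

text \<open>A change at one client moves the global mean by only \<open>1 / M\<close> of it, hence
  the factor \<open>real M\<close>.\<close>

lemma gap_glob_shift:
  assumes "1 < K" "unique_bests mu K M" "k < K" "m < M"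
  obtains s j where "\<bar>s\<bar> = real M * gap_glob mu K M k" "s \<noteq> 0" "j < K" "j \<noteq> global_best mu K M"
    "global_mean (shift mu k m s) M (global_best mu K M) \<le> global_mean (shift mu k m s) M j"
proof -
  let ?b = "global_best mu K M" and ?f = "global_mean mu M"
  have M: "0 < real M" using assms(4) by simp
  have b: "?b < K" "\<And>j. j < K \<Longrightarrow> j \<noteq> ?b \<Longrightarrow> ?f j < ?f ?b"
    using is_global_best_global_best[OF assms(2)] by (auto simp: is_global_best_def)
  show ?thesis
  proof (rule gap_as_shift[where f = ?f, OF assms(1) b assms(3)])
    fix s j
    assume s: "\<bar>s\<bar> = (if k = ?b then Min {?f ?b - ?f j | j. j < K \<and> j \<noteq> ?b} else ?f ?b - ?f k)"
      and j: "s \<noteq> 0" "j < K" "j \<noteq> ?b"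
      and le: "?f ?b + (if ?b = k then s else 0) \<le> ?f j + (if j = k then s else 0)"
    have "\<bar>s\<bar> = gap_glob mu K M k" using s by (simp add: gap_glob_def Let_def)
    then have "\<bar>real M * s\<bar> = real M * gap_glob mu K M k" by (simp add: abs_mult)
    moreover have "(if i = k then real M * s else 0) / real M = (if i = k then s else 0)" for i
      using M by simp
    then have "global_mean (shift mu k m (real M * s)) M ?b \<le> global_mean (shift mu k m (real M * s)) M j"
      unfolding global_mean_shift[OF assms(4)] using le by simp
    moreover have "real M * s \<noteq> 0" using j M by simp
    ultimately show thesis using j by (intro that)
  qed
qed

subsection \<open>The lower bound\<close>

lemma sets_correct_output:
  assumes "delta_PAC R K M \<delta> alg" "\<delta> < 1" "unique_bests mu K M"
  shows "{x \<in> space (model R mu). correct_output mu K M alg (fst x) (snd x)} \<in> sets (model R mu)"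
  \<comment> \<open>otherwise its \<^const>\<open>measure\<close> would be the junk value 0\<close>
proof (rule ccontr)
  assume "\<not> ?thesis"
  then have "measure (model R mu) {x \<in> space (model R mu). correct_output mu K M alg (fst x) (snd x)} = 0"
    by (rule measure_notin_sets)
  moreover have "measure (model R mu) {x \<in> space (model R mu). correct_output mu K M alg (fst x) (snd x)} \<ge> 1 - \<delta>"
    using assms(1,3) unfolding delta_PAC_def by blast
  ultimately show False using assms(2) by simp
qed

lemma prob_space_model:
  assumes "prob_space R"
  shows "prob_space (model R mu)"
proof -
  interpret R: prob_space R by fact
  interpret T: prob_space "table_measure mu" by (rule prob_space_table_measure)
  interpret P: pair_prob_space R "table_measure mu" ..
  show ?thesis unfolding model_eq by (rule P.prob_space_axioms)
qed

text \<open>The shifted instance only has a tie, so it is approached by instances with unique best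
  arms and another correct answer, at distance at most \<open>2 * \<eta>\<close>. Under each of them
  the PAC property gives \<open>S\<close> probability at most \<open>\<delta>\<close>.\<close>

lemma exp_pulls_lower_bound:
  assumes KM: "1 < K" "1 < M" and \<delta>: "0 < \<delta>" "\<delta> < 1" and uniq: "unique_bests mu K M"
    and R: "prob_space R" and valid: "valid_policy K M alg" and pac: "delta_PAC R K M \<delta> alg"
    and km: "k0 < K" "m0 < M" and s: "s \<noteq> 0" and j: "j < K"
    and alt: "(\<exists>m<M. j \<noteq> local_best mu K m
          \<and> shift mu k0 m0 s (local_best mu K m) m \<le> shift mu k0 m0 s j m)
      \<or> (j \<noteq> global_best mu K M
          \<and> global_mean (shift mu k0 m0 s) M (global_best mu K M) \<le> global_mean (shift mu k0 m0 s) M j)"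
    and S: "S = {x \<in> space (model R mu). answers mu K M (alg (fst x) (run_hist alg (fst x) (snd x) N))}"
    and Sm: "S \<in> sets (model R mu)" and a: "0 \<le> a"
  shows "ennreal ((a * measure (model R mu) S - ln (1 + (exp a - 1) * \<delta>)) / (s\<^sup>2 / 2))
    \<le> (\<integral>\<^sup>+u. exp_pulls mu alg u k0 m0 N [] \<partial>R)"
proof -
  let ?p = "measure (model R mu) S" and ?E = "\<integral>\<^sup>+u. exp_pulls mu alg u k0 m0 N [] \<partial>R"
  have bound: "ennreal ((a * ?p - ln (1 + (exp a - 1) * \<delta>) - real N * ((2 * \<eta>)\<^sup>2 / 2)) / ((\<bar>s\<bar> + 2 * \<eta>)\<^sup>2 / 2)) \<le> ?E"
    if \<eta>: "0 < \<eta>" for \<eta>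
  proof (rule unique_bests_perturbation[of K M \<eta> j "shift mu k0 m0 s"])
    show "0 < K" "0 < M" using KM by simp_all
    show "0 < \<eta>" "j < K" by fact+
  next
    fix mu'
    assume u': "unique_bests mu' K M"
      and close: "\<And>k m. k < K \<Longrightarrow> \<bar>mu' k m - shift mu k0 m0 s k m\<bar> \<le> 2 * \<eta>"
      and loc: "\<And>b m. b < K \<Longrightarrow> b \<noteq> j \<Longrightarrow> shift mu k0 m0 s b m \<le> shift mu k0 m0 s j m \<Longrightarrow> mu' b m < mu' j m"
      and glob: "\<And>b. b < K \<Longrightarrow> b \<noteq> j \<Longrightarrow> global_mean (shift mu k0 m0 s) M b \<le> global_mean (shift mu k0 m0 s) M j
        \<Longrightarrow> global_mean mu' M b < global_mean mu' M j"
    \<comment> \<open>In \<open>mu'\<close> arm \<open>j\<close> strictly beats the arm that was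
      best in \<open>mu\<close>, for some client or globally.\<close>
    have differ: "(\<exists>m<M. local_best mu' K m \<noteq> local_best mu K m) \<or> global_best mu' K M \<noteq> global_best mu K M"
      using alt
    proof
      assume "\<exists>m<M. j \<noteq> local_best mu K m \<and> shift mu k0 m0 s (local_best mu K m) m \<le> shift mu k0 m0 s j m"
      then obtain m where m: "m < M" "j \<noteq> local_best mu K m"
        "shift mu k0 m0 s (local_best mu K m) m \<le> shift mu k0 m0 s j m" by blast
      have "local_best mu K m < K"
        using is_local_best_local_best[OF uniq m(1)] by (simp add: is_local_best_def)
      then have "mu' (local_best mu K m) m < mu' j m" using m by (intro loc) auto
      then have "local_best mu' K m \<noteq> local_best mu K m"
        using is_local_best_local_best[OF u' m(1)] j m(2) unfolding is_local_best_def
        by (metis less_asym)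
      then show ?thesis using m(1) by blast
    next
      assume *: "j \<noteq> global_best mu K M
          \<and> global_mean (shift mu k0 m0 s) M (global_best mu K M) \<le> global_mean (shift mu k0 m0 s) M j"
      have "global_best mu K M < K"
        using is_global_best_global_best[OF uniq] by (simp add: is_global_best_def)
      then have "global_mean mu' M (global_best mu K M) < global_mean mu' M j"
        using * by (intro glob) auto
      then have "global_best mu' K M \<noteq> global_best mu K M"
        using is_global_best_global_best[OF u'] j * unfolding is_global_best_def
        by (metis less_asym)
      then show ?thesis by blast
    qed
    interpret Q: prob_space "model R mu'" using R by (rule prob_space_model)
    let ?A' = "{x \<in> space (model R mu'). correct_output mu' K M alg (fst x) (snd x)}"
    have A': "?A' \<in> sets (model R mu')" using sets_correct_output[OF pac \<delta>(2) u'] .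
    have Sm': "S \<in> sets (model R mu')" using Sm sets_model by blast
    \<comment> \<open>One output cannot be correct for both instances, since their answers
      differ.\<close>
    have "S \<inter> ?A' = {}"
    proof -
      have False if "correct_output mu K M alg u w" "correct_output mu' K M alg u w" for u w
        using that differ by (auto simp: correct_output_def split: action.splits)
      then show ?thesis unfolding S by (auto simp: answers_run_hist_iff)
    qed
    then have "measure (model R mu') S + measure (model R mu') ?A' = measure (model R mu') (S \<union> ?A')"
      using Sm' A' by (simp add: Q.finite_measure_Union)
    also have "\<dots> \<le> 1" by (rule Q.prob_le_1)
    finally have "measure (model R mu') S \<le> 1 - measure (model R mu') ?A'" by simp
    also have "\<dots> \<le> \<delta>" using pac u' unfolding delta_PAC_def by force
    finally have q: "measure (model R mu') S \<le> \<delta>" .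
    have "1 + (exp a - 1) * measure (model R mu') S \<le> 1 + (exp a - 1) * \<delta>"
      using q a by (intro add_left_mono mult_left_mono) auto
    moreover have "0 < 1 + (exp a - 1) * measure (model R mu') S"
      using a by (intro add_pos_nonneg mult_nonneg_nonneg) auto
    ultimately have ln: "ln (1 + (exp a - 1) * measure (model R mu') S) \<le> ln (1 + (exp a - 1) * \<delta>)"
      by (intro ln_mono) auto
    have \<kappa>0: "0 < (\<bar>s\<bar> + 2 * \<eta>)\<^sup>2 / 2" using s \<eta> by (simp add: add_pos_pos)
    have \<kappa>: "(mu' k0 m0 - mu k0 m0)\<^sup>2 / 2 \<le> (\<bar>s\<bar> + 2 * \<eta>)\<^sup>2 / 2"
    proof -
      have "\<bar>mu' k0 m0 - mu k0 m0\<bar> \<le> \<bar>s\<bar> + 2 * \<eta>" using close[OF km(1), of m0] by simp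
      then show ?thesis by (metis abs_le_square_iff abs_of_nonneg abs_ge_zero order_trans divide_right_mono zero_le_numeral)
    qed
    have e: "(mu' k m - mu k m)\<^sup>2 / 2 \<le> (2 * \<eta>)\<^sup>2 / 2" if "k < K" "m < M" "\<not> (k = k0 \<and> m = m0)" for k m
    proof -
      have "\<bar>mu' k m - mu k m\<bar> \<le> \<bar>2 * \<eta>\<bar>" using close[OF that(1), of m] that(3) \<eta> by auto
      then show ?thesis by (metis abs_le_square_iff divide_right_mono zero_le_numeral)
    qed
    have "ennreal ((a * ?p - ln (1 + (exp a - 1) * \<delta>) - real N * ((2 * \<eta>)\<^sup>2 / 2)) / ((\<bar>s\<bar> + 2 * \<eta>)\<^sup>2 / 2))
      \<le> ennreal ((a * ?p - ln (1 + (exp a - 1) * measure (model R mu') S) - real N * ((2 * \<eta>)\<^sup>2 / 2)) / ((\<bar>s\<bar> + 2 * \<eta>)\<^sup>2 / 2))"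
      using ln \<kappa>0 by (intro ennreal_leI divide_right_mono) auto
    also have "\<dots> \<le> ?E"
      using change_of_measure_model[OF R valid S Sm \<kappa>0 \<kappa> _ e a] by simp
    finally show ?thesis .
  qed
  \<comment> \<open>The horizon \<open>N\<close> stays fixed as \<open>\<eta>\<close> tends to 0, so
    the accumulated slack vanishes and the displacement becomes
    \<open>\<bar>s\<bar>\<close>.\<close>
  have "((\<lambda>\<eta>. ennreal ((a * ?p - ln (1 + (exp a - 1) * \<delta>) - real N * ((2 * \<eta>)\<^sup>2 / 2)) / ((\<bar>s\<bar> + 2 * \<eta>)\<^sup>2 / 2)))
      \<longlongrightarrow> ennreal ((a * ?p - ln (1 + (exp a - 1) * \<delta>) - real N * ((2 * 0)\<^sup>2 / 2)) / ((\<bar>s\<bar> + 2 * 0)\<^sup>2 / 2))) (at_right 0)"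
    using s by (intro tendsto_intros) auto
  moreover have "eventually (\<lambda>\<eta>::real. 0 < \<eta>) (at_right 0)"
    by (rule eventually_at_right_less)
  then have "eventually (\<lambda>\<eta>. ennreal ((a * ?p - ln (1 + (exp a - 1) * \<delta>) - real N * ((2 * \<eta>)\<^sup>2 / 2)) / ((\<bar>s\<bar> + 2 * \<eta>)\<^sup>2 / 2)) \<le> ?E) (at_right 0)"
    by (rule eventually_mono) (rule bound)
  ultimately have "ennreal ((a * ?p - ln (1 + (exp a - 1) * \<delta>) - real N * ((2 * 0)\<^sup>2 / 2)) / ((\<bar>s\<bar> + 2 * 0)\<^sup>2 / 2)) \<le> ?E"
    by (rule tendsto_upperbound) simp
  then show ?thesis by simp
qed

section \<open>A numerical bound on the binary relative entropy\<close>

text \<open>The right side is the relative entropy \<open>kl(1 - d, d)\<close>. The quantity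
  \<open>- ln (4 * d * (1 - d))\<close> lies between the two sides: its distance to the right side
  is twice the relative entropy of a \<open>d\<close>-coin with respect to a fair coin.\<close>

lemma binary_kl_lower_bound:
  fixes d :: real
  assumes "0 < d" "d < 1"
  shows "ln (1 / (2.4 * d)) / 2 \<le> (1 - 2 * d) * ln ((1 - d) / d)"
proof -
  \<comment> \<open>The maximum of the cubic on the interval, attained at \<open>1 / 3\<close>. As
    \<open>4 / 27\<close> is below \<open>0.15\<close>, multiplication by \<open>16 * d\<close>
    yields the constant \<open>2.4\<close>.\<close>
  have "d * (1 - d)\<^sup>2 \<le> 4 / 27"
  proof -
    have "4 / 27 - d * (1 - d)\<^sup>2 = (d - 1 / 3)\<^sup>2 * (4 / 3 - d)"
      by (simp add: power2_eq_square field_simps)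
    moreover have "0 \<le> (d - 1 / 3)\<^sup>2 * (4 / 3 - d)" using assms by (intro mult_nonneg_nonneg) auto
    ultimately show ?thesis by linarith
  qed
  then have "d * (1 - d)\<^sup>2 * (16 * d) \<le> 0.15 * (16 * d)"
    using assms by (intro mult_right_mono) auto
  then have "(4 * d * (1 - d))\<^sup>2 \<le> 2.4 * d"
    by (simp add: power2_eq_square algebra_simps)
  then have "ln ((4 * d * (1 - d))\<^sup>2) \<le> ln (2.4 * d)"
    using assms by (intro ln_mono) auto
  then have "2 * ln (4 * d * (1 - d)) \<le> ln (2.4 * d)"
    using assms by (simp add: ln_realpow)
  then have 1: "ln (1 / (2.4 * d)) / 2 \<le> - ln (4 * d * (1 - d))"
    using assms by (simp add: ln_div)
  have l: "1 - 1 / x \<le> ln x" if "0 < x" for x :: real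
    using ln_le_minus_one[of "1 / x"] that by (simp add: ln_div)
  \<comment> \<open>The lower bounds \<open>1 - 1 / x\<close> for the two logarithms average to
    zero, so the entropy with respect to the fair coin is nonnegative.\<close>
  have "0 = (1 - d) * (1 - 1 / (2 * (1 - d))) + d * (1 - 1 / (2 * d))"
    using assms by (simp add: field_simps)
  also have "\<dots> \<le> (1 - d) * ln (2 * (1 - d)) + d * ln (2 * d)"
    using assms l[of "2 * (1 - d)"] l[of "2 * d"] by (intro add_mono mult_left_mono) auto
  finally have "0 \<le> (1 - d) * ln (2 * (1 - d)) + d * ln (2 * d)" .
  moreover have l1: "ln (2 * (1 - d)) = ln 2 + ln (1 - d)"
    using assms by (subst ln_mult) auto
  moreover have l2: "ln (2 * d) = ln 2 + ln d" and l3: "ln (4 * d * (1 - d)) = 2 * ln 2 + ln d + ln (1 - d)"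
    and l4: "ln ((1 - d) / d) = ln (1 - d) - ln d"
    using assms ln_realpow[of 2 2] by (simp_all add: ln_mult ln_div)
  ultimately have "0 \<le> (1 - d) * (ln 2 + ln (1 - d)) + d * (ln 2 + ln d)" by simp
  then have "- ln (4 * d * (1 - d)) \<le> (1 - 2 * d) * ln ((1 - d) / d)"
    unfolding l3 l4 by (simp add: algebra_simps)
  with 1 show ?thesis by simp
qed

lemma ennreal_sum_le: "ennreal (\<Sum>i\<in>I. f i) \<le> (\<Sum>i\<in>I. ennreal (f i))"
proof (induction I rule: infinite_finite_induct)
  case (insert i I)
  then show ?case using ennreal_add_le[of "f i" "sum f I"] by (simp add: add_left_mono order_trans)
qed auto

theorem theorem3:
  fixes K M :: nat and \<delta> :: real and mu :: "nat \<Rightarrow> nat \<Rightarrow> real"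
    and R :: "'r measure" and alg :: "'r policy"
  assumes "K > 1" and "M > 1" and "0 < \<delta>" and "\<delta> < 1"
    and "unique_bests mu K M"
    and "prob_space R"
    and "valid_policy K M alg"
    and "(\<lambda>x. stop_time alg (fst x) (snd x)) \<in> borel_measurable (model R mu)"
    and "delta_PAC R K M \<delta> alg"
  shows "ennreal (\<Sum>k<K. \<Sum>m<M.
            max (ln (1 / (2.4 * \<delta>)) / (gap_loc mu K k m)\<^sup>2)
                (ln (1 / (2.4 * \<delta>)) / ((real M)\<^sup>2 * (gap_glob mu K M k)\<^sup>2)))
         \<le> (\<integral>\<^sup>+ x. stop_time alg (fst x) (snd x) \<partial>model R mu)"
\<comment> \<open>For such large \<open>\<delta>\<close> the sum is nonpositive and
  \<open>ennreal\<close> makes it 0.\<close>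
proof (cases "1 / (2.4 * \<delta>) \<le> 1")
  case True
  then have "ln (1 / (2.4 * \<delta>)) \<le> 0" using assms(3) by (subst ln_le_zero_iff) auto
  then have "(\<Sum>k<K. \<Sum>m<M.
            max (ln (1 / (2.4 * \<delta>)) / (gap_loc mu K k m)\<^sup>2)
                (ln (1 / (2.4 * \<delta>)) / ((real M)\<^sup>2 * (gap_glob mu K M k)\<^sup>2))) \<le> 0"
    by (intro sum_nonpos) (auto intro!: divide_nonpos_nonneg)
  then show ?thesis by (simp add: ennreal_neg)
next
  case False
  define L where "L = ln (1 / (2.4 * \<delta>))"
  have L: "0 < L" unfolding L_def using False by (intro ln_gt_zero) simp
  have half: "\<delta> < 1 / 2" using False assms(3) by (simp add: field_simps)
  \<comment> \<open>The maximizer of \<open>a * p - ln (1 + (exp a - 1) * q)\<close> at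
    \<open>p = 1 - \<delta>\<close>, \<open>q = \<delta>\<close>, where the value is the binary
    relative entropy. It is nonnegative because \<open>\<delta> < 1 / 2\<close>.\<close>
  define a where "a = 2 * ln ((1 - \<delta>) / \<delta>)"
  have a: "0 \<le> a" using half assms(3) by (simp add: a_def field_simps)
  have "exp a = ((1 - \<delta>) / \<delta>)\<^sup>2"
    using assms(3,4) by (simp add: a_def exp_double)
  then have ea: "1 + (exp a - 1) * \<delta> = (1 - \<delta>) / \<delta>"
    using assms(3) by (simp add: power2_eq_square field_simps)
  interpret P: prob_space "model R mu" using assms(6) by (rule prob_space_model)
  define A where "A = {x \<in> space (model R mu). correct_output mu K M alg (fst x) (snd x)}"
  define S where "S = (\<lambda>N. {x \<in> space (model R mu).
    answers mu K M (alg (fst x) (run_hist alg (fst x) (snd x) N))})"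
  have Am: "A \<in> sets (model R mu)"
    unfolding A_def using assms(9,4,5) by (rule sets_correct_output)
  have SA: "S N = A \<inter> {x \<in> space (model R mu). stop_time alg (fst x) (snd x) \<le> of_nat N}" for N
    by (auto simp: S_def A_def answers_run_hist_iff)
  have Sm: "S N \<in> sets (model R mu)" for N
    unfolding SA using assms(8) Am by measurable
  define v where "v = (\<lambda>p. a * p - ln (1 + (exp a - 1) * \<delta>))"
  \<comment> \<open>A correct output presupposes stopping, so the events of a correct answer by time
    \<open>N\<close> increase to \<open>A\<close>.\<close>
  have lim: "(\<lambda>N. measure (model R mu) (S N)) \<longlonglongrightarrow> measure (model R mu) A"
  proof -
    have "(\<Union>N. S N) = A"
    proof -
      have "\<exists>N. stop_time alg u w \<le> of_nat N" if "correct_output mu K M alg u w" for u w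
        using that by (auto simp: correct_output_def stop_time_def)
      then show ?thesis unfolding SA by (auto simp: A_def)
    qed
    moreover have "incseq S"
    proof (rule incseq_SucI)
      fix n
      have "of_nat n \<le> (of_nat (Suc n) :: ennreal)" by (intro of_nat_mono) simp
      then show "S n \<subseteq> S (Suc n)" unfolding SA by (auto intro: order_trans)
    qed
    ultimately show ?thesis
      using P.finite_Lim_measure_incseq[of S] Sm by auto
  qed
  have PA: "1 - \<delta> \<le> measure (model R mu) A"
    using assms(5,9) unfolding delta_PAC_def A_def by blast
  have vA: "L \<le> 2 * v (measure (model R mu) A)"
  proof -
    have "L / 2 \<le> (1 - 2 * \<delta>) * ln ((1 - \<delta>) / \<delta>)"
      unfolding L_def by (rule binary_kl_lower_bound) (use assms in auto)
    also have "\<dots> = a * (1 - \<delta>) - ln ((1 - \<delta>) / \<delta>)"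
      by (simp add: a_def algebra_simps)
    also have "\<dots> \<le> v (measure (model R mu) A)"
      unfolding v_def ea using mult_left_mono[OF PA a] by simp
    finally show ?thesis by simp
  qed
  \<comment> \<open>The better of the two displacements for each pair; the 2 from
    \<open>s\<^sup>2 / 2\<close> is kept outside and compensates the half in
    \<open>binary_kl_lower_bound\<close>.\<close>
  define W where "W = (\<lambda>k m. max (1 / (gap_loc mu K k m)\<^sup>2) (1 / (real M * gap_glob mu K M k)\<^sup>2))"
  have pulls: "ennreal (2 * v (measure (model R mu) (S N)) * W k m)
      \<le> (\<integral>\<^sup>+u. exp_pulls mu alg u k m N [] \<partial>R)" if km: "k < K" "m < M" for N k m
  proof -
    note bound = exp_pulls_lower_bound[OF assms(1-7,9) km _ _ _ S_def[THEN fun_cong, of N] Sm a]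
    have "ennreal (v (measure (model R mu) (S N)) / ((gap_loc mu K k m)\<^sup>2 / 2))
        \<le> (\<integral>\<^sup>+u. exp_pulls mu alg u k m N [] \<partial>R)"
    proof (rule gap_loc_shift[OF assms(1,5) km])
      fix s j
      assume s: "\<bar>s\<bar> = gap_loc mu K k m" "s \<noteq> 0" and j: "j < K" "j \<noteq> local_best mu K m"
        "shift mu k m s (local_best mu K m) m \<le> shift mu k m s j m"
      have "s\<^sup>2 = (gap_loc mu K k m)\<^sup>2" by (simp flip: s(1))
      moreover have "\<exists>m'<M. j \<noteq> local_best mu K m'
          \<and> shift mu k m s (local_best mu K m') m' \<le> shift mu k m s j m'"
        using j km(2) by blast
      ultimately show ?thesis using bound[OF s(2) j(1)] by (simp add: v_def)
    qed
    moreover have "ennreal (v (measure (model R mu) (S N)) / ((real M * gap_glob mu K M k)\<^sup>2 / 2))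
        \<le> (\<integral>\<^sup>+u. exp_pulls mu alg u k m N [] \<partial>R)"
    proof (rule gap_glob_shift[OF assms(1,5) km])
      fix s j
      assume s: "\<bar>s\<bar> = real M * gap_glob mu K M k" "s \<noteq> 0" and j: "j < K" "j \<noteq> global_best mu K M"
        "global_mean (shift mu k m s) M (global_best mu K M) \<le> global_mean (shift mu k m s) M j"
      have "s\<^sup>2 = (real M * gap_glob mu K M k)\<^sup>2" by (simp flip: s(1))
      then show ?thesis using bound[OF s(2) j(1)] j by (simp add: v_def)
    qed
    ultimately show ?thesis unfolding W_def max_def by (auto simp: mult_ac)
  qed
  have "ennreal (2 * v (measure (model R mu) (S N)) * (\<Sum>k<K. \<Sum>m<M. W k m))
      \<le> (\<integral>\<^sup>+x. stop_time alg (fst x) (snd x) \<partial>model R mu)" for N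
  proof -
    interpret T: prob_space "table_measure mu" by (rule prob_space_table_measure)
    have Tm: "(\<lambda>x. stop_time alg (fst x) (snd x)) \<in> borel_measurable (R \<Otimes>\<^sub>M table_measure mu)"
      using assms(8) by (simp add: model_eq)
    have "ennreal (2 * v (measure (model R mu) (S N)) * (\<Sum>k<K. \<Sum>m<M. W k m))
        = ennreal (\<Sum>k<K. \<Sum>m<M. 2 * v (measure (model R mu) (S N)) * W k m)"
      by (simp add: sum_distrib_left)
    also have "\<dots> \<le> (\<Sum>k<K. ennreal (\<Sum>m<M. 2 * v (measure (model R mu) (S N)) * W k m))"
      by (rule ennreal_sum_le)
    also have "\<dots> \<le> (\<Sum>k<K. \<Sum>m<M. ennreal (2 * v (measure (model R mu) (S N)) * W k m))"
      by (intro sum_mono ennreal_sum_le)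
    also have "\<dots> \<le> (\<Sum>k<K. \<Sum>m<M. \<integral>\<^sup>+u. exp_pulls mu alg u k m N [] \<partial>R)"
      by (intro sum_mono pulls) auto
    also have "\<dots> \<le> (\<Sum>k<K. \<integral>\<^sup>+u. (\<Sum>m<M. exp_pulls mu alg u k m N []) \<partial>R)"
      by (intro sum_mono nn_integral_sum_superadditive)
    also have "\<dots> \<le> (\<integral>\<^sup>+u. (\<Sum>k<K. \<Sum>m<M. exp_pulls mu alg u k m N []) \<partial>R)"
      by (rule nn_integral_sum_superadditive)
    also have "\<dots> \<le> (\<integral>\<^sup>+u. \<integral>\<^sup>+w. stop_time alg u w \<partial>table_measure mu \<partial>R)"
    proof (rule nn_integral_mono)
      fix u assume u: "u \<in> space R"
      have "stop_time alg u \<in> borel_measurable (table_measure mu)"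
        using measurable_compose[OF measurable_Pair1'[OF u] Tm] by simp
      then have "stop_time alg u \<in> borel_measurable (PiM UNIV (\<lambda>_. borel))"
        by (simp add: measurable_table_measure)
      from sum_exp_pulls_le_stop_time[OF this replays_Nil]
      show "(\<Sum>k<K. \<Sum>m<M. exp_pulls mu alg u k m N []) \<le> (\<integral>\<^sup>+w. stop_time alg u w \<partial>table_measure mu)"
        by simp
    qed
    also have "\<dots> = (\<integral>\<^sup>+x. stop_time alg (fst x) (snd x) \<partial>model R mu)"
      unfolding model_eq using T.nn_integral_fst[OF Tm] by simp
    finally show ?thesis .
  qed
  \<comment> \<open>The upper bound does not depend on \<open>N\<close>, so the horizon can be
    released now that the slack is gone.\<close>
  moreover have "(\<lambda>N. ennreal (2 * v (measure (model R mu) (S N)) * (\<Sum>k<K. \<Sum>m<M. W k m)))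
      \<longlonglongrightarrow> ennreal (2 * v (measure (model R mu) A) * (\<Sum>k<K. \<Sum>m<M. W k m))"
    unfolding v_def by (intro tendsto_intros lim)
  ultimately have T: "ennreal (2 * v (measure (model R mu) A) * (\<Sum>k<K. \<Sum>m<M. W k m))
      \<le> (\<integral>\<^sup>+x. stop_time alg (fst x) (snd x) \<partial>model R mu)"
    by (intro LIMSEQ_le_const2) auto
  have "max (L / x) (L / y) = L * max (1 / x) (1 / y)" for x y
    using L by (simp add: max_mult_distrib_left)
  then have "(\<Sum>k<K. \<Sum>m<M. max (L / (gap_loc mu K k m)\<^sup>2) (L / ((real M)\<^sup>2 * (gap_glob mu K M k)\<^sup>2)))
      = L * (\<Sum>k<K. \<Sum>m<M. W k m)"
    by (simp add: W_def sum_distrib_left power_mult_distrib)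
  also have "\<dots> \<le> 2 * v (measure (model R mu) A) * (\<Sum>k<K. \<Sum>m<M. W k m)"
    using vA by (intro mult_right_mono sum_nonneg) (auto simp: W_def le_max_iff_disj)
  finally have "(\<Sum>k<K. \<Sum>m<M. max (L / (gap_loc mu K k m)\<^sup>2) (L / ((real M)\<^sup>2 * (gap_glob mu K M k)\<^sup>2)))
      \<le> 2 * v (measure (model R mu) A) * (\<Sum>k<K. \<Sum>m<M. W k m)" .
  from order_trans[OF ennreal_leI[OF this] T] show ?thesis unfolding L_def .
qed

end
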